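(* Let $$\mathcal R_\varepsilon(n,K,a,b,\beta):=\inf_{M:\ \varepsilon\text{-node-DP}}\ \sup_{\Theta(n,K,a,b,\beta)}\mathbb E\,r(\sigma_0,M(A)).$$ Assume the signal--entropy separation assumption and the mild-growth assumption on $K$ (stated in the context), and suppose in addition that $a,b=o(n)$, $a\gtrsim\log n$ and $K=O(1)$. Then there exist universal constants $L,c_{\mathrm{sig}},c_{\mathrm{priv}},C_{\mathrm{sig}},C_{\mathrm{priv}}>0$ such that, for all sufficiently large $n$, if $\varepsilon\ge L\log n$, then $$e^{-C_{\mathrm{sig}}\mathrm{Signal}}+e^{-C_{\mathrm{priv}}\varepsilon}\ \lesssim\ \mathcal R_\varepsilon(n,K,a,b,\beta)\ \lesssim\ e^{-c_{\mathrm{sig}}\mathrm{Signal}}+e^{-c_{\mathrm{priv}}\varepsilon}.$$ Equivalently, $$\mathcal R_\varepsilon(n,K,a,b,\beta)=\exp\{-\Theta(\mathrm{Signal})\}+\exp\{-\Theta(\varepsilon)\}.$$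
   Context: Graphs on $[n]=\{1,\dots,n\}$ are identified with symmetric zero-diagonal matrices $A\in\{0,1\}^{n\times n}$. $A\sim_v A'$ (node-adjacent) if $A,A'$ differ only in the incident edges of a single vertex $v$. A randomized mechanism $M$ mapping graphs on $[n]$ to labelings in $[K]^n$ is $\varepsilon$-node-DP if $\mathbb P(M(A)\in S)\le e^{\varepsilon}\,\mathbb P(M(A')\in S)$ for all measurable $S$ and all $A\sim_v A'$. Model. $n\ge2$, $K\ge2$, $\beta\ge1$, and if $K\ge3$ also $1\le\beta<\sqrt{5/3}$. $K,a,b,\varepsilon$ may depend on $n$; asymptotic notation is as $n\to\infty$. $\Sigma_\beta$ (assumed nonempty) is the set of $\sigma:[n]\to[K]$ with $\frac{n}{\beta K}\le|\{i:\sigma(i)=k\}|\le\frac{\beta n}{K}$ for all $k\in[K]$. For $\sigma_0\in\Sigma_\beta$ and $n>a>b\ge0$, $A\sim\mathrm{SBM}(\sigma_0)$ means: the entries $A_{ij}$, $i<j$, are independent with $\mathbb P(A_{ij}=1)=a/n$ if $\sigma_0(i)=\sigma_0(j)$ and $b/n$ otherwise. $\Theta(n,K,a,b,\beta)$ is the family of these laws over $\sigma_0\in\Sigma_\beta$. Constant-SNR standing assumption: there are constants $0<\rho_-\le\rho_+<1$ with $\rho_-\le b/a\le\rho_+$ for all large $n$. "Universal" and implied constants do not depend on $n$; the regime parameters $\rho_\pm$, $\beta$ and the implied constants in $K=O(1)$, $a\gtrsim\log n$ are regarded as fixed. $x\lesssim y$ (or $y\gtrsim x$) means $x\le C'y$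 for a constant $C'>0$. Loss. $r(\sigma,\hat\sigma):=\min_{\pi\in S_K}\frac1n\sum_{i=1}^n\mathbf 1\{\sigma(i)\ne\pi(\hat\sigma(i))\}$, with $S_K$ the permutations of $[K]$. Information. $I=-2\log\big(\sqrt{\tfrac an\tfrac bn}+\sqrt{(1-\tfrac an)(1-\tfrac bn)}\big)$; $\mathrm{Signal}:=nI/2$ if $K=2$ and $\mathrm{Signal}:=nI/(\beta K)$ if $K\ge3$. Signal--entropy separation assumption: for a sufficiently large absolute constant $C_s>0$, $\mathrm{Signal}\ge C_s\log(nK)$ for all sufficiently large $n$. Mild-growth assumption: there is an absolute constant $C_{\mathrm{mg}}>0$ with $\log(nK)\ge C_{\mathrm{mg}}K\log K$ for all sufficiently large $n$. *)

theory Defs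
  imports "HOL-Probability.Probability" "HOL-Library.FuncSet"
    "HOL-Library.Landau_Symbols" "HOL-Combinatorics.Permutations"
begin

text \<open>A graph on \<open>{1..n}\<close> is its adjacency matrix, with \<open>A i j = True\<close> standing for the entry 1 and
  all entries outside \<open>{1..n} \<times> {1..n}\<close> equal to \<open>False\<close>, so that each graph has a unique
  representative. Likewise labelings are extensional functions on \<open>{1..n}\<close>.\<close>

type_synonym graph = "nat \<Rightarrow> nat \<Rightarrow> bool"
type_synonym labeling = "nat \<Rightarrow> nat"

definition graphs :: "nat \<Rightarrow> graph set" where
  "graphs n = {A. (\<forall>i j. A i j = A j i) \<and> (\<forall>i. \<not> A i i) \<and>
                  (\<forall>i j. A i j \<longrightarrow> i \<in> {1..n} \<and> j \<in> {1..n})}"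

definition labelings :: "nat \<Rightarrow> nat \<Rightarrow> labeling set" where
  "labelings n K = {1..n} \<rightarrow>\<^sub>E {1..K}"

definition node_adjacent :: "nat \<Rightarrow> graph \<Rightarrow> graph \<Rightarrow> bool" where
  "node_adjacent n A A' \<longleftrightarrow>
     (\<exists>v\<in>{1..n}. \<forall>i\<in>{1..n}. \<forall>j\<in>{1..n}. i \<noteq> v \<longrightarrow> j \<noteq> v \<longrightarrow> A i j = A' i j)"

text \<open>Since there are finitely many labelings, a Markov kernel from graphs to labelings is a
  \<open>pmf\<close>-valued map, and every set of labelings is measurable. The values of \<open>M\<close> at arguments outside
  \<open>graphs n\<close> play no role.\<close>

definition node_DP :: "nat \<Rightarrow> nat \<Rightarrow> real \<Rightarrow> (graph \<Rightarrow> labeling pmf) \<Rightarrow> bool" where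
  "node_DP n K \<epsilon> M \<longleftrightarrow>
     (\<forall>A\<in>graphs n. set_pmf (M A) \<subseteq> labelings n K) \<and>
     (\<forall>A\<in>graphs n. \<forall>A'\<in>graphs n. node_adjacent n A A' \<longrightarrow>
        (\<forall>S. measure_pmf.prob (M A) S \<le> exp \<epsilon> * measure_pmf.prob (M A') S))"

definition Sigma_beta :: "nat \<Rightarrow> nat \<Rightarrow> real \<Rightarrow> labeling set" where
  "Sigma_beta n K \<beta> = {\<sigma> \<in> labelings n K. \<forall>k\<in>{1..K}.
      real n / (\<beta> * real K) \<le> real (card {i \<in> {1..n}. \<sigma> i = k}) \<and>
      real (card {i \<in> {1..n}. \<sigma> i = k}) \<le> \<beta> * real n / real K}"

text \<open>\<open>Pi_pmf\<close> draws the entries above the diagonal independently (and is \<open>False\<close> at all other index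
  pairs); the result is then symmetrised.\<close>

definition SBM :: "nat \<Rightarrow> real \<Rightarrow> real \<Rightarrow> labeling \<Rightarrow> graph pmf" where
  "SBM n a b \<sigma> = map_pmf (\<lambda>X i j. X (min i j, max i j))
     (Pi_pmf {(i, j). 1 \<le> i \<and> i < j \<and> j \<le> n} False
        (\<lambda>(i, j). bernoulli_pmf (if \<sigma> i = \<sigma> j then a / real n else b / real n)))"

definition loss :: "nat \<Rightarrow> nat \<Rightarrow> labeling \<Rightarrow> labeling \<Rightarrow> real" where
  "loss n K \<sigma> \<tau> = (MIN \<pi>\<in>{\<pi>. \<pi> permutes {1..K}}.
      1 / real n * (\<Sum>i = 1..n. of_bool (\<sigma> i \<noteq> \<pi> (\<tau> i))))"

definition risk :: "nat \<Rightarrow> nat \<Rightarrow> real \<Rightarrow> real \<Rightarrow> (graph \<Rightarrow> labeling pmf) \<Rightarrow> labeling \<Rightarrow> real" where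
  "risk n K a b M \<sigma>\<^sub>0 = measure_pmf.expectation (bind_pmf (SBM n a b \<sigma>\<^sub>0) M) (loss n K \<sigma>\<^sub>0)"

definition minimax_risk :: "real \<Rightarrow> nat \<Rightarrow> nat \<Rightarrow> real \<Rightarrow> real \<Rightarrow> real \<Rightarrow> real" where
  "minimax_risk \<epsilon> n K a b \<beta> =
     (INF M\<in>{M. node_DP n K \<epsilon> M}. SUP \<sigma>\<^sub>0\<in>Sigma_beta n K \<beta>. risk n K a b M \<sigma>\<^sub>0)"

definition SBM_info :: "nat \<Rightarrow> real \<Rightarrow> real \<Rightarrow> real" where
  "SBM_info n a b = - 2 * ln (sqrt (a / real n * (b / real n))
                            + sqrt ((1 - a / real n) * (1 - b / real n)))"

definition Signal :: "nat \<Rightarrow> nat \<Rightarrow> real \<Rightarrow> real \<Rightarrow> real \<Rightarrow> real" where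
  "Signal n K a b \<beta> = (if K = 2 then real n * SBM_info n a b / 2
                       else real n * SBM_info n a b / (\<beta> * real K))"

definition SBM_model :: "nat \<Rightarrow> nat \<Rightarrow> real \<Rightarrow> real \<Rightarrow> real \<Rightarrow> bool" where
  "SBM_model n K a b \<beta> \<longleftrightarrow> n \<ge> 2 \<and> K \<ge> 2 \<and> \<beta> \<ge> 1 \<and> (K \<ge> 3 \<longrightarrow> \<beta> < sqrt (5 / 3)) \<and>
     real n > a \<and> a > b \<and> b \<ge> 0 \<and> Sigma_beta n K \<beta> \<noteq> {}"

end

(* Upper bound. Call a graph recoverable for a labeling s if, after deleting any set of nodes that is small
   compared with the mismatch of s and t, the likelihood of s still exceeds that of t, for every t. If A is
   recoverable for s and B for t, then A and B cannot agree off a small set of nodes, since s and t would each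
   have to beat the other there. So the exponential mechanism whose score of t is the node distance of the
   input to the graphs recoverable for t is private (node distances change by at most one) and, on inputs
   recoverable for s, outputs t with weight at most exp (- eps c m / 2), where m is the mismatch; for
   eps >= L log n this beats the n^m K^m labelings at mismatch m. An SBM graph is recoverable for its own
   labeling up to probability exp (- c Signal) by a union bound over t and the deleted set, with the
   Bhattacharyya bound exp (- N I / 2) for each test: N, the number of surviving pairs on which s and t
   disagree about "same community", is of order m n / K.

   Lower bound. Swap the labels of two nodes. The two models differ in at most 2 n edges, so Le Cam's
   method with the Hellinger affinity exp (- I / 2) per edge gives exp (- 2 n I); privacy applied to the two
   nodes gives exp (- 4 eps). The mismatch is at least one node, and the resulting factor 1 / n, like all
   constants, is absorbed by the exponents. *)
theory Submission
  imports Defs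
begin

section \<open>Disagreement pairs of two labelings\<close>

definition hamming :: "nat \<Rightarrow> labeling \<Rightarrow> labeling \<Rightarrow> nat" where
  "hamming n \<sigma> \<tau> = card {i \<in> {1..n}. \<sigma> i \<noteq> \<tau> i}"

text \<open>This is \<open>n\<close> times \<open>loss\<close>, kept as a natural number because it
  serves as an exponent and in counting arguments.\<close>

definition mismatch :: "nat \<Rightarrow> nat \<Rightarrow> labeling \<Rightarrow> labeling \<Rightarrow> nat" where
  "mismatch n K \<sigma> \<tau> = (MIN \<pi>\<in>{\<pi>. \<pi> permutes {1..K}}. hamming n \<sigma> (\<pi> \<circ> \<tau>))"

definition node_pairs :: "nat \<Rightarrow> nat set \<Rightarrow> (nat \<times> nat) set" where
  "node_pairs n V = {(i, j). 1 \<le> i \<and> i < j \<and> j \<le> n \<and> i \<notin> V \<and> j \<notin> V}"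

text \<open>Only the partitions into communities enter, so relabeling is invisible. For
  \<open>p \<noteq> q\<close> these are the surviving pairs whose edge probability differs between
  the two models.\<close>

definition disagree :: "nat \<Rightarrow> nat set \<Rightarrow> labeling \<Rightarrow> labeling \<Rightarrow> (nat \<times> nat) set" where
  "disagree n V \<sigma> \<tau> = {(i, j) \<in> node_pairs n V. (\<sigma> i = \<sigma> j) \<noteq> (\<tau> i = \<tau> j)}"

lemma finite_node_pairs [simp]: "finite (node_pairs n V)"
  by (rule finite_subset[of _ "{1..n} \<times> {1..n}"]) (auto simp: node_pairs_def)

lemma finite_disagree [simp]: "finite (disagree n V \<sigma> \<tau>)"
  by (rule finite_subset[OF _ finite_node_pairs[of n V]]) (auto simp: disagree_def)

lemma finite_permutes: "finite {\<pi>. \<pi> permutes {1..K::nat}}"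
  by (simp add: finite_permutations)

lemma permutes_nonempty: "{\<pi>. \<pi> permutes {1..K::nat}} \<noteq> {}"
  using permutes_id by blast

lemma permutes_labelings:
  assumes "\<pi> permutes {1..K}" "\<tau> \<in> labelings n K"
  shows "restrict (\<pi> \<circ> \<tau>) {1..n} \<in> labelings n K"
  using assms permutes_in_image[OF assms(1)] by (auto simp: labelings_def PiE_def Pi_def)

lemma mismatch_obtain:
  obtains \<pi> where "\<pi> permutes {1..K}" "hamming n \<sigma> (\<pi> \<circ> \<tau>) = mismatch n K \<sigma> \<tau>"
proof -
  have "mismatch n K \<sigma> \<tau> \<in> (\<lambda>\<pi>. hamming n \<sigma> (\<pi> \<circ> \<tau>)) ` {\<pi>. \<pi> permutes {1..K}}"
    unfolding mismatch_def by (intro Min_in finite_imageI finite_permutes) (use permutes_nonempty in blast)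
  then show ?thesis using that by auto
qed

lemma mismatch_le: "\<pi> permutes {1..K} \<Longrightarrow> mismatch n K \<sigma> \<tau> \<le> hamming n \<sigma> (\<pi> \<circ> \<tau>)"
  unfolding mismatch_def by (intro Min_le finite_imageI finite_permutes) auto

lemma hamming_le: "hamming n \<sigma> \<tau> \<le> n"
  unfolding hamming_def by (rule order.trans[OF card_mono[of "{1..n}"]]) auto

lemma mismatch_le_n: "mismatch n K \<sigma> \<tau> \<le> n"
  using mismatch_le[OF permutes_id] hamming_le order.trans by blast

text \<open>The inverse of an optimal relabeling of \<open>\<tau>\<close> relabels
  \<open>\<sigma>\<close> with the same errors.\<close>

lemma mismatch_sym_le: "mismatch n K \<tau> \<sigma> \<le> mismatch n K \<sigma> \<tau>"
proof -
  obtain \<pi> where p: "\<pi> permutes {1..K}" "hamming n \<sigma> (\<pi> \<circ> \<tau>) = mismatch n K \<sigma> \<tau>"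
    by (rule mismatch_obtain)
  have "hamming n \<tau> (inv \<pi> \<circ> \<sigma>) = hamming n \<sigma> (\<pi> \<circ> \<tau>)"
  proof -
    have "(\<tau> i \<noteq> (inv \<pi> \<circ> \<sigma>) i) = (\<sigma> i \<noteq> (\<pi> \<circ> \<tau>) i)" for i
      by (metis comp_apply permutes_inv_eq[OF p(1)])
    then show ?thesis by (simp add: hamming_def)
  qed
  then show ?thesis using mismatch_le[OF permutes_inv[OF p(1)], of n \<tau> \<sigma>] p(2) by simp
qed

lemma mismatch_sym: "mismatch n K \<tau> \<sigma> = mismatch n K \<sigma> \<tau>"
  by (simp add: mismatch_sym_le antisym)

lemma loss_eq: "loss n K \<sigma> \<tau> = real (mismatch n K \<sigma> \<tau>) / real n"
proof -
  let ?P = "{\<pi>. \<pi> permutes {1..K}}"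
  have eq: "1 / real n * (\<Sum>i = 1..n. of_bool (\<sigma> i \<noteq> \<pi> (\<tau> i))) = real (hamming n \<sigma> (\<pi> \<circ> \<tau>)) / real n" for \<pi>
    by (simp add: hamming_def of_bool_def sum.If_cases Int_def)
  have "mono (\<lambda>k::nat. real k / real n)"
    by (auto intro!: monoI divide_right_mono)
  then have "real (mismatch n K \<sigma> \<tau>) / real n = Min ((\<lambda>k. real k / real n) ` (\<lambda>\<pi>. hamming n \<sigma> (\<pi> \<circ> \<tau>)) ` ?P)"
    unfolding mismatch_def
    by (intro mono_Min_commute finite_imageI finite_permutes) (auto simp only: image_is_empty permutes_nonempty)
  then show ?thesis unfolding loss_def eq by (simp add: image_image)
qed

text \<open>The complements of domain and image within \<open>{1..K}\<close> have equal size, so any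
  bijection between them completes \<open>f\<close>. This turns a partial matching of communities
  into a relabeling.\<close>

lemma partial_injection_extends:
  fixes f :: "nat \<Rightarrow> nat"
  assumes "A \<subseteq> {1..K}" "inj_on f A" "f ` A \<subseteq> {1..K}"
  obtains \<pi> where "\<pi> permutes {1..K}" "\<And>x. x \<in> A \<Longrightarrow> \<pi> x = f x"
proof -
  have fin: "finite A" using assms(1) finite_subset by blast
  have c: "card ({1..K} - A) = card ({1..K} - f ` A)"
    using assms fin by (simp add: card_Diff_subset card_image)
  then obtain g where g: "bij_betw g ({1..K} - A) ({1..K} - f ` A)"
    using finite_same_card_bij[of "{1..K} - A" "{1..K} - f ` A"] by auto
  define \<pi> where "\<pi> x = (if x \<in> A then f x else if x \<in> {1..K} then g x else x)" for x
  have "bij_betw \<pi> A (f ` A)"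
    using assms(2) by (auto simp: bij_betw_def \<pi>_def inj_on_def)
  moreover have "bij_betw \<pi> ({1..K} - A) ({1..K} - f ` A)"
    using g by (subst bij_betw_cong[of _ \<pi> g]) (auto simp: \<pi>_def)
  ultimately have "bij_betw \<pi> (A \<union> ({1..K} - A)) (f ` A \<union> ({1..K} - f ` A))"
    by (intro bij_betw_combine) auto
  moreover have "A \<union> ({1..K} - A) = {1..K}" "f ` A \<union> ({1..K} - f ` A) = {1..K}"
    using assms by auto
  ultimately have "\<pi> permutes {1..K}"
    using assms(1) by (intro bij_imp_permutes) (auto simp: \<pi>_def)
  then show ?thesis using that by (auto simp: \<pi>_def)
qed

text \<open>Double counting: the ordered pairs on the left are the pairs of \<open>disagree\<close>
  together with their swaps, and the diagonal contributes nothing.\<close>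

lemma sum_card_disagree:
  "(\<Sum>i\<in>{1..n}. card {j \<in> {1..n}. (\<sigma> i = \<sigma> j) \<noteq> (\<tau> i = \<tau> j)}) = 2 * card (disagree n {} \<sigma> \<tau>)"
proof -
  let ?D = "disagree n {} \<sigma> \<tau>"
  let ?S = "SIGMA i:{1..n}. {j \<in> {1..n}. (\<sigma> i = \<sigma> j) \<noteq> (\<tau> i = \<tau> j)}"
  have "?S = ?D \<union> prod.swap ` ?D"
  proof (intro equalityI subsetI)
    fix x assume "x \<in> ?S"
    then obtain i j where x: "x = (i, j)" "i \<in> {1..n}" "j \<in> {1..n}" "(\<sigma> i = \<sigma> j) \<noteq> (\<tau> i = \<tau> j)"
      by auto
    then have "i < j \<or> j < i" by (metis linorder_neqE_nat)
    then show "x \<in> ?D \<union> prod.swap ` ?D"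
    proof
      assume "i < j" then show ?thesis using x by (auto simp: disagree_def node_pairs_def)
    next
      assume "j < i"
      then have "(j, i) \<in> ?D" using x by (auto simp: disagree_def node_pairs_def)
      then show ?thesis using x(1) by (auto intro!: image_eqI[of _ _ "(j, i)"])
    qed
  qed (auto simp: disagree_def node_pairs_def)
  moreover have "?D \<inter> prod.swap ` ?D = {}"
    by (auto simp: disagree_def node_pairs_def)
  moreover have "card (prod.swap ` ?D) = card ?D" by (intro card_image) auto
  ultimately have "card ?S = 2 * card ?D"
    by (simp add: card_Un_disjoint)
  then show ?thesis by simp
qed

text \<open>Match community \<open>k\<close> of \<open>\<sigma>\<close> with community
  \<open>l\<close> of \<open>\<tau>\<close> when their overlap is more than half of each. The
  matching is injective, so it extends to a relabeling whose errors all lie in the set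
  \<open>U\<close> of unmatched nodes. Each unmatched node lies in at least \<open>s / 2\<close>
  disagreement pairs, and summing over nodes counts each pair twice; hence the factor 4.\<close>

lemma card_disagree_ge:
  fixes s :: real
  assumes \<sigma>: "\<sigma> \<in> labelings n K" and \<tau>: "\<tau> \<in> labelings n K"
    and sizes: "\<And>k. k \<in> {1..K} \<Longrightarrow> s \<le> real (card {i \<in> {1..n}. \<sigma> i = k})"
      "\<And>k. k \<in> {1..K} \<Longrightarrow> s \<le> real (card {i \<in> {1..n}. \<tau> i = k})"
    and "s \<ge> 0"
  shows "s * real (mismatch n K \<sigma> \<tau>) \<le> 4 * real (card (disagree n {} \<sigma> \<tau>))"
proof -
  define C where "C k = {i \<in> {1..n}. \<sigma> i = k}" for k
  define T where "T l = {i \<in> {1..n}. \<tau> i = l}" for l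
  define maj where "maj k l \<longleftrightarrow> card (C k) < 2 * card (C k \<inter> T l) \<and> card (T l) < 2 * card (C k \<inter> T l)" for k l
  define U where "U = {i \<in> {1..n}. \<not> maj (\<sigma> i) (\<tau> i)}"
  have fin [simp]: "finite (C k)" "finite (T k)" for k by (auto simp: C_def T_def)
  have lab: "\<sigma> i \<in> {1..K}" "\<tau> i \<in> {1..K}" if "i \<in> {1..n}" for i
    using \<sigma> \<tau> that by (auto simp: labelings_def)
  \<comment> \<open>Two overlaps that are each more than half of the same community cannot be
    disjoint.\<close>
  have majsym: False if "maj k l" "maj k l'" "l \<noteq> l'" for k l l'
  proof -
    have "card (C k \<inter> T l) + card (C k \<inter> T l') = card ((C k \<inter> T l) \<union> (C k \<inter> T l'))"
      using that(3) by (intro card_Un_disjoint[symmetric]) (auto simp: T_def)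
    also have "\<dots> \<le> card (C k)" by (intro card_mono) auto
    finally show False using that by (auto simp: maj_def)
  qed
  have majsym': False if "maj k l" "maj k' l" "k \<noteq> k'" for k k' l
  proof -
    have "card (C k \<inter> T l) + card (C k' \<inter> T l) = card ((C k \<inter> T l) \<union> (C k' \<inter> T l))"
      using that(3) by (intro card_Un_disjoint[symmetric]) (auto simp: C_def)
    also have "\<dots> \<le> card (T l)" by (intro card_mono) auto
    finally show False using that by (auto simp: maj_def)
  qed
  define A where "A = {l \<in> {1..K}. \<exists>k\<in>{1..K}. maj k l}"
  define f where "f l = (SOME k. k \<in> {1..K} \<and> maj k l)" for l
  have f: "f l \<in> {1..K} \<and> maj (f l) l" if "l \<in> A" for l
    unfolding f_def by (rule someI_ex) (use that in \<open>auto simp: A_def\<close>)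
  obtain \<pi> where \<pi>: "\<pi> permutes {1..K}" "\<And>l. l \<in> A \<Longrightarrow> \<pi> l = f l"
  proof (rule partial_injection_extends[of A K f])
    show "inj_on f A" using f majsym by (intro inj_onI) metis
    show "f ` A \<subseteq> {1..K}" using f by blast
  qed (auto simp: A_def)
  have "{i \<in> {1..n}. \<sigma> i \<noteq> (\<pi> \<circ> \<tau>) i} \<subseteq> U"
  proof
    fix i assume i: "i \<in> {i \<in> {1..n}. \<sigma> i \<noteq> (\<pi> \<circ> \<tau>) i}"
    show "i \<in> U"
    proof (rule ccontr)
      assume "i \<notin> U"
      then have m: "maj (\<sigma> i) (\<tau> i)" using i by (auto simp: U_def)
      then have "\<tau> i \<in> A" using lab[of i] i by (auto simp: A_def)
      then have "f (\<tau> i) = \<sigma> i" using f majsym' m by metis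
      then show False using i \<pi>(2)[OF \<open>\<tau> i \<in> A\<close>] by simp
    qed
  qed
  then have "hamming n \<sigma> (\<pi> \<circ> \<tau>) \<le> card U"
    unfolding hamming_def by (intro card_mono) (auto simp: U_def)
  then have mU: "mismatch n K \<sigma> \<tau> \<le> card U" using mismatch_le[OF \<pi>(1)] order.trans by blast
  \<comment> \<open>The community of \<open>i\<close> in \<open>\<sigma>\<close> or that in
    \<open>\<tau>\<close> has at least half of its nodes outside the overlap; these are together
    with \<open>i\<close> in one labeling only.\<close>
  have half: "s \<le> 2 * real (card {j \<in> {1..n}. (\<sigma> i = \<sigma> j) \<noteq> (\<tau> i = \<tau> j)})" if "i \<in> U" for i
  proof -
    let ?J = "{j \<in> {1..n}. (\<sigma> i = \<sigma> j) \<noteq> (\<tau> i = \<tau> j)}"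
    have i: "i \<in> {1..n}" using that by (auto simp: U_def)
    have "2 * card (C (\<sigma> i) \<inter> T (\<tau> i)) \<le> card (C (\<sigma> i)) \<or> 2 * card (C (\<sigma> i) \<inter> T (\<tau> i)) \<le> card (T (\<tau> i))"
      using that by (auto simp: U_def maj_def)
    then show ?thesis
    proof
      assume h: "2 * card (C (\<sigma> i) \<inter> T (\<tau> i)) \<le> card (C (\<sigma> i))"
      have "card (C (\<sigma> i)) = card (C (\<sigma> i) \<inter> T (\<tau> i)) + card (C (\<sigma> i) - T (\<tau> i))"
        by (rule card_Int_Diff) simp
      moreover have "card (C (\<sigma> i) - T (\<tau> i)) \<le> card ?J"
        by (intro card_mono) (auto simp: C_def T_def)
      moreover have "s \<le> real (card (C (\<sigma> i)))" using sizes(1)[OF lab(1)[OF i]] by (simp add: C_def)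
      ultimately show ?thesis using h by linarith
    next
      assume h: "2 * card (C (\<sigma> i) \<inter> T (\<tau> i)) \<le> card (T (\<tau> i))"
      have "card (T (\<tau> i)) = card (C (\<sigma> i) \<inter> T (\<tau> i)) + card (T (\<tau> i) - C (\<sigma> i))"
        using card_Int_Diff[of "T (\<tau> i)" "C (\<sigma> i)"] by (simp add: Int_commute)
      moreover have "card (T (\<tau> i) - C (\<sigma> i)) \<le> card ?J"
        by (intro card_mono) (auto simp: C_def T_def)
      moreover have "s \<le> real (card (T (\<tau> i)))" using sizes(2)[OF lab(2)[OF i]] by (simp add: T_def)
      ultimately show ?thesis using h by linarith
    qed
  qed
  have "s * real (mismatch n K \<sigma> \<tau>) \<le> real (card U) * s"
    using mult_left_mono[of "real (mismatch n K \<sigma> \<tau>)" "real (card U)" s] mU \<open>s \<ge> 0\<close>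
    by (simp add: mult.commute)
  also have "\<dots> = (\<Sum>i\<in>U. s)" by simp
  also have "\<dots> \<le> (\<Sum>i\<in>U. 2 * real (card {j \<in> {1..n}. (\<sigma> i = \<sigma> j) \<noteq> (\<tau> i = \<tau> j)}))"
    by (intro sum_mono half)
  also have "\<dots> \<le> (\<Sum>i\<in>{1..n}. 2 * real (card {j \<in> {1..n}. (\<sigma> i = \<sigma> j) \<noteq> (\<tau> i = \<tau> j)}))"
    by (intro sum_mono2) (auto simp: U_def)
  also have "\<dots> = 2 * real (\<Sum>i\<in>{1..n}. card {j \<in> {1..n}. (\<sigma> i = \<sigma> j) \<noteq> (\<tau> i = \<tau> j)})"
    by (simp add: sum_distrib_left)
  finally show ?thesis unfolding sum_card_disagree by simp
qed

text \<open>With two communities the constant must not degrade with the imbalance \<open>\<beta>\<close>.\<close>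

lemma card_disagree_ge_two:
  assumes \<sigma>: "\<sigma> \<in> labelings n 2" and \<tau>: "\<tau> \<in> labelings n 2"
  shows "n * mismatch n 2 \<sigma> \<tau> \<le> 2 * card (disagree n {} \<sigma> \<tau>)"
proof -
  define D where "D = {i \<in> {1..n}. \<sigma> i \<noteq> \<tau> i}"
  define E where "E = {i \<in> {1..n}. \<sigma> i = \<tau> i}"
  have lab: "\<sigma> i \<in> {1, 2}" "\<tau> i \<in> {1, 2}" if "i \<in> {1..n}" for i
    using \<sigma> \<tau> that by (auto simp: labelings_def PiE_def Pi_def numeral_2_eq_2 le_Suc_eq)
  have DE: "{1..n} = D \<union> E" "D \<inter> E = {}" "finite D" "finite E" by (auto simp: D_def E_def)
  have n: "n = card D + card E"
    using card_Un_disjoint[of D E] DE by (metis card_atLeastAtMost diff_Suc_1)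
  let ?J = "\<lambda>i. {j \<in> {1..n}. (\<sigma> i = \<sigma> j) \<noteq> (\<tau> i = \<tau> j)}"
  \<comment> \<open>With two labels, \<open>i\<close> and \<open>j\<close> form a disagreement
    exactly when one of them is in \<open>D\<close> and the other in \<open>E\<close>: the
    disagreement pairs are complete bipartite.\<close>
  have "?J i = (if i \<in> D then E else D)" if "i \<in> {1..n}" for i
  proof -
    have "j \<in> ?J i \<longleftrightarrow> j \<in> (if i \<in> D then E else D)" if j: "j \<in> {1..n}" for j
      using lab[OF that] lab[OF \<open>i \<in> {1..n}\<close>] \<open>i \<in> {1..n}\<close> j unfolding D_def E_def by auto
    moreover have "?J i \<subseteq> {1..n}" "(if i \<in> D then E else D) \<subseteq> {1..n}" by (auto simp: D_def E_def)
    ultimately show ?thesis by blast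
  qed
  then have "(\<Sum>i\<in>{1..n}. card (?J i)) = (\<Sum>i\<in>{1..n}. card (if i \<in> D then E else D))"
    by (intro sum.cong) auto
  also have "\<dots> = (\<Sum>i\<in>D. card (if i \<in> D then E else D)) + (\<Sum>i\<in>E. card (if i \<in> D then E else D))"
    unfolding DE(1) using DE by (intro sum.union_disjoint) auto
  also have "(\<Sum>i\<in>D. card (if i \<in> D then E else D)) = (\<Sum>i\<in>D. card E)" by (intro sum.cong) auto
  also have "(\<Sum>i\<in>E. card (if i \<in> D then E else D)) = (\<Sum>i\<in>E. card D)"
    using DE(2) by (intro sum.cong) auto
  finally have c: "card (disagree n {} \<sigma> \<tau>) = card D * card E"
    unfolding sum_card_disagree by (simp add: mult.commute)
  have mD: "mismatch n 2 \<sigma> \<tau> \<le> card D"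
    using mismatch_le[OF permutes_id, of n 2 \<sigma> \<tau>] by (simp add: hamming_def D_def)
  \<comment> \<open>Exchanging the two labels of \<open>\<tau>\<close> turns agreement into
    disagreement, so the size of \<open>E\<close> bounds the mismatch as well.\<close>
  have "Transposition.transpose 1 2 permutes {1..2::nat}" by (intro permutes_swap_id) auto
  then have "mismatch n 2 \<sigma> \<tau> \<le> hamming n \<sigma> (Transposition.transpose 1 2 \<circ> \<tau>)" by (rule mismatch_le)
  also have "{i \<in> {1..n}. \<sigma> i \<noteq> (Transposition.transpose 1 2 \<circ> \<tau>) i} = E"
    unfolding E_def using lab by (fastforce simp: Transposition.transpose_def)
  then have "hamming n \<sigma> (Transposition.transpose 1 2 \<circ> \<tau>) = card E" by (simp add: hamming_def)
  finally have mE: "mismatch n 2 \<sigma> \<tau> \<le> card E" .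
  \<comment> \<open>The mismatch is at most the size of either part, so splitting \<open>n\<close>
    costs only a factor 2, however unequal the parts are.\<close>
  have "n * mismatch n 2 \<sigma> \<tau> = card D * mismatch n 2 \<sigma> \<tau> + card E * mismatch n 2 \<sigma> \<tau>"
    by (subst n) (simp add: algebra_simps)
  also have "\<dots> \<le> card D * card E + card E * card D"
    using mD mE by (intro add_mono mult_mono) auto
  finally show ?thesis using c by (simp add: mult.commute)
qed

text \<open>A lost pair meets \<open>V\<close>, and sorting \<open>(v, i)\<close> with
  \<open>v\<close> in \<open>V\<close> reaches every such pair.\<close>

lemma card_disagree_restrict:
  assumes "V \<subseteq> {1..n}"
  shows "card (disagree n {} \<sigma> \<tau>) \<le> card (disagree n V \<sigma> \<tau>) + card V * n"
proof -
  let ?g = "\<lambda>(v, i). (min v i, max v i)"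
  have fin: "finite V" using assms finite_subset by blast
  have "disagree n {} \<sigma> \<tau> \<subseteq> disagree n V \<sigma> \<tau> \<union> ?g ` (V \<times> {1..n})"
  proof
    fix x assume x: "x \<in> disagree n {} \<sigma> \<tau>"
    then obtain i j where ij: "x = (i, j)" "1 \<le> i" "i < j" "j \<le> n"
      by (auto simp: disagree_def node_pairs_def)
    consider "i \<in> V" | "j \<in> V" | "i \<notin> V" "j \<notin> V" by blast
    then show "x \<in> disagree n V \<sigma> \<tau> \<union> ?g ` (V \<times> {1..n})"
    proof cases
      case 1 then show ?thesis using ij by (intro UnI2 image_eqI[of _ _ "(i, j)"]) auto
    next
      case 2 then show ?thesis using ij by (intro UnI2 image_eqI[of _ _ "(j, i)"]) auto
    next
      case 3 then show ?thesis using x ij by (auto simp: disagree_def node_pairs_def)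
    qed
  qed
  then have "card (disagree n {} \<sigma> \<tau>) \<le> card (disagree n V \<sigma> \<tau> \<union> ?g ` (V \<times> {1..n}))"
    using fin by (intro card_mono) auto
  also have "\<dots> \<le> card (disagree n V \<sigma> \<tau>) + card (?g ` (V \<times> {1..n}))" by (rule card_Un_le)
  also have "card (?g ` (V \<times> {1..n})) \<le> card (V \<times> {1..n})"
    using fin by (intro card_image_le) auto
  also have "card (V \<times> {1..n}) = card V * n"
    by (simp add: card_cartesian_product)
  finally show ?thesis by simp
qed

section \<open>Generating function of the Hamming distance\<close>

text \<open>The power factorises over nodes, so the sum over labelings is a product; at each node
  one label contributes 1 and the other \<open>K - 1\<close> contribute \<open>x\<close>.\<close>

lemma sum_power_hamming:
  assumes "\<sigma> \<in> labelings n K"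
  shows "(\<Sum>\<tau>\<in>labelings n K. x ^ hamming n \<sigma> \<tau>) = (1 + real (K - 1) * x) ^ n"
proof -
  have "x ^ hamming n \<sigma> \<tau> = (\<Prod>i\<in>{1..n}. if \<sigma> i = \<tau> i then 1 else x)" for \<tau>
  proof -
    have "(\<Prod>i\<in>{1..n}. if \<sigma> i = \<tau> i then 1 else x) = (\<Prod>i\<in>{i \<in> {1..n}. \<sigma> i \<noteq> \<tau> i}. x)"
      by (rule prod.mono_neutral_cong_right) auto
    then show ?thesis by (simp add: hamming_def)
  qed
  then have "(\<Sum>\<tau>\<in>labelings n K. x ^ hamming n \<sigma> \<tau>)
      = (\<Sum>\<tau>\<in>{1..n} \<rightarrow>\<^sub>E {1..K}. \<Prod>i\<in>{1..n}. if \<sigma> i = \<tau> i then 1 else x)"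
    by (simp add: labelings_def)
  also have "\<dots> = (\<Prod>i\<in>{1..n}. \<Sum>y\<in>{1..K}. if \<sigma> i = y then 1 else x)"
    by (subst prod_sum_PiE) auto
  also have "\<dots> = (\<Prod>i\<in>{1..n}. 1 + real (K - 1) * x)"
  proof (intro prod.cong refl)
    fix i assume "i \<in> {1..n}"
    then have i: "\<sigma> i \<in> {1..K}" using assms by (auto simp: labelings_def)
    have "(\<Sum>y\<in>{1..K}. if \<sigma> i = y then 1 else x) = 1 + (\<Sum>y\<in>{1..K} - {\<sigma> i}. if \<sigma> i = y then 1 else x)"
      using i by (subst sum.remove[of _ "\<sigma> i"]) auto
    also have "(\<Sum>y\<in>{1..K} - {\<sigma> i}. if \<sigma> i = y then 1 else x) = (\<Sum>y\<in>{1..K} - {\<sigma> i}. x)"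
      by (intro sum.cong) auto
    finally show "(\<Sum>y\<in>{1..K}. if \<sigma> i = y then 1 else x) = 1 + real (K - 1) * x"
      using i by (simp add: card_Diff_singleton)
  qed
  finally show ?thesis by simp
qed

lemma finite_labelings [simp]: "finite (labelings n K)"
  unfolding labelings_def by (intro finite_PiE) auto

text \<open>Put \<open>z = n K x\<close>, at most 1. Without the term 1 of \<open>\<sigma>\<close>
  the sum is at most \<open>exp z - 1\<close>, hence at most \<open>z + z^2\<close> and at most
  \<open>2 z\<close>.\<close>

lemma sum_power_hamming_le:
  assumes "\<sigma> \<in> labelings n K" "x \<ge> 0" "real n * (real K * x) \<le> 1"
  shows "(\<Sum>\<tau>\<in>labelings n K - {\<sigma>}. x ^ hamming n \<sigma> \<tau>) \<le> 2 * (real n * (real K * x))"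
proof -
  have "(\<Sum>\<tau>\<in>labelings n K - {\<sigma>}. x ^ hamming n \<sigma> \<tau>) = (1 + real (K - 1) * x) ^ n - 1"
    using sum_power_hamming[OF assms(1), of x] assms(1)
    by (subst sum_diff1) (auto simp: hamming_def)
  also have "(1 + real (K - 1) * x) ^ n \<le> (1 + real K * x) ^ n"
    using assms by (intro power_mono add_left_mono mult_right_mono) auto
  also have "\<dots> \<le> exp (real K * x) ^ n"
    using assms by (intro power_mono exp_ge_add_one_self) auto
  also have "\<dots> = exp (real n * (real K * x))" by (simp add: exp_of_nat_mult)
  also have "\<dots> \<le> 1 + real n * (real K * x) + (real n * (real K * x))\<^sup>2"
    using assms by (intro exp_bound) auto
  also have "(real n * (real K * x))\<^sup>2 \<le> real n * (real K * x) * 1"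
    unfolding power2_eq_square using assms by (intro mult_left_mono) auto
  finally show ?thesis by linarith
qed

section \<open>Testing between Bernoulli products\<close>

text \<open>The Bhattacharyya coefficient (Hellinger affinity) of the Bernoulli laws with parameters
  \<open>p\<close> and \<open>q\<close>.\<close>

definition affinity :: "real \<Rightarrow> real \<Rightarrow> real" where
  "affinity p q = sqrt (p * q) + sqrt ((1 - p) * (1 - q))"

lemma affinity_self: "0 \<le> p \<Longrightarrow> p \<le> 1 \<Longrightarrow> affinity p p = 1"
  by (simp add: affinity_def)

lemma affinity_pos: "0 < p \<Longrightarrow> p < 1 \<Longrightarrow> 0 < q \<Longrightarrow> q < 1 \<Longrightarrow> 0 < affinity p q"
  by (simp add: affinity_def add_pos_pos)

lemma affinity_commute: "affinity p q = affinity q p"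
  by (simp add: affinity_def mult.commute)

lemma finite_set_Pi_pmf_bool:
  fixes P :: "'i \<Rightarrow> bool pmf"
  assumes "finite A"
  shows "finite (set_pmf (Pi_pmf A d P))"
  using finite_PiE_dflt[OF assms, of "set_pmf \<circ> P" d] set_Pi_pmf_subset'[OF assms, of d P]
    finite_subset by fastforce

lemma pmf_bernoulli_pos: "0 < p \<Longrightarrow> p < 1 \<Longrightarrow> 0 < pmf (bernoulli_pmf p) y"
  by (cases y) auto

lemma sqrt_prod: "sqrt (\<Prod>x\<in>A. f x) = (\<Prod>x\<in>A. sqrt (f x))"
  by (induction A rule: infinite_finite_induct) (auto simp: real_sqrt_mult)

lemma sqrt_divide_mult:
  fixes u v :: real
  assumes "u > 0"
  shows "sqrt (v / u) * u = sqrt (u * v)"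
proof -
  have "sqrt (u * v) = sqrt ((v / u) * u\<^sup>2)" using assms by (simp add: power2_eq_square)
  then show ?thesis using assms by (simp only: real_sqrt_mult) simp
qed

context
  fixes A E :: "'i set" and s t :: "'i \<Rightarrow> real" and p q :: real
  assumes finA: "finite A" and EA: "E \<subseteq> A"
    and pq: "0 < p" "p < 1" "0 < q" "q < 1"
    and st: "\<And>x. s x \<in> {p, q}" "\<And>x. t x \<in> {p, q}"
begin

lemma st_bounds: "0 < s x" "s x < 1" "0 < t x" "t x < 1"
  using st[of x] pq by auto

text \<open>By independence the expectation is a product over coordinates, with the affinity as
  factor where \<open>s\<close> and \<open>t\<close> differ and 1 elsewhere. The product runs over a
  subset \<open>E\<close> because the tests see only the pairs that survive deletion.\<close>

lemma expectation_sqrt_likelihood_ratio: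
  "measure_pmf.expectation (Pi_pmf A d (\<lambda>x. bernoulli_pmf (s x)))
     (\<lambda>X. \<Prod>x\<in>E. sqrt (pmf (bernoulli_pmf (t x)) (X x) / pmf (bernoulli_pmf (s x)) (X x)))
   = affinity p q ^ card {x \<in> E. s x \<noteq> t x}"
proof -
  let ?r = "\<lambda>x y. sqrt (pmf (bernoulli_pmf (t x)) y / pmf (bernoulli_pmf (s x)) y)"
  \<comment> \<open>Padding with the constant 1 outside \<open>E\<close> lets the product run over
    all of \<open>A\<close>, where independence applies.\<close>
  let ?f = "\<lambda>x y. if x \<in> E then ?r x y else 1"
  have finE: "finite E" using finA EA finite_subset by blast
  have "(\<Prod>x\<in>E. ?r x (X x)) = (\<Prod>x\<in>A. ?f x (X x))" for X
    using finA EA by (intro prod.mono_neutral_cong_left) auto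
  then have "measure_pmf.expectation (Pi_pmf A d (\<lambda>x. bernoulli_pmf (s x))) (\<lambda>X. \<Prod>x\<in>E. ?r x (X x))
      = measure_pmf.expectation (Pi_pmf A d (\<lambda>x. bernoulli_pmf (s x))) (\<lambda>X. \<Prod>x\<in>A. ?f x (X x))"
    by simp
  also have "\<dots> = (\<Prod>x\<in>A. measure_pmf.expectation (bernoulli_pmf (s x)) (?f x))"
    using finA by (intro expectation_prod_Pi_pmf integrable_measure_pmf_finite) auto
  also have "\<dots> = (\<Prod>x\<in>E. measure_pmf.expectation (bernoulli_pmf (s x)) (?r x))"
    using finA EA by (intro prod.mono_neutral_cong_right) auto
  also have "\<dots> = (\<Prod>x\<in>E. if s x \<noteq> t x then affinity p q else 1)"
  proof (intro prod.cong refl)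
    fix x
    note b = st_bounds[of x]
    have "measure_pmf.expectation (bernoulli_pmf (s x)) (?r x) = affinity (s x) (t x)"
      using b sqrt_divide_mult[of "s x" "t x"] sqrt_divide_mult[of "1 - s x" "1 - t x"] by (simp add: affinity_def)
    also have "\<dots> = (if s x \<noteq> t x then affinity p q else 1)"
    proof (cases "s x = t x")
      case True
      then show ?thesis using b affinity_self[of "t x"] by simp
    next
      case False
      then have "s x = p \<and> t x = q \<or> s x = q \<and> t x = p" using st[of x] by auto
      then show ?thesis using False affinity_commute[of p q] by metis
    qed
    finally show "measure_pmf.expectation (bernoulli_pmf (s x)) (?r x)
      = (if s x \<noteq> t x then affinity p q else 1)" .
  qed
  also have "\<dots> = (\<Prod>x\<in>{x \<in> E. s x \<noteq> t x}. affinity p q)"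
    using finE by (intro prod.mono_neutral_cong_right) auto
  finally show ?thesis by simp
qed

text \<open>On the error event the likelihood ratio is at least 1, so the indicator is at most its
  square root: a Chernoff bound with exponent one half.\<close>

lemma likelihood_test_error:
  "measure_pmf.prob (Pi_pmf A d (\<lambda>x. bernoulli_pmf (s x)))
     {X. (\<Prod>x\<in>E. pmf (bernoulli_pmf (s x)) (X x)) \<le> (\<Prod>x\<in>E. pmf (bernoulli_pmf (t x)) (X x))}
   \<le> affinity p q ^ card {x \<in> E. s x \<noteq> t x}" (is "measure_pmf.prob ?M ?S \<le> _")
proof -
  let ?u = "\<lambda>X. \<Prod>x\<in>E. pmf (bernoulli_pmf (s x)) (X x)"
  let ?v = "\<lambda>X. \<Prod>x\<in>E. pmf (bernoulli_pmf (t x)) (X x)"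
  let ?f = "\<lambda>X. \<Prod>x\<in>E. sqrt (pmf (bernoulli_pmf (t x)) (X x) / pmf (bernoulli_pmf (s x)) (X x))"
  have f: "?f X = sqrt (?v X / ?u X)" for X
    by (simp add: sqrt_prod[symmetric] prod_dividef)
  have upos: "?u X > 0" for X by (intro prod_pos) (use st_bounds in \<open>auto intro!: pmf_bernoulli_pos\<close>)
  have vpos: "?v X > 0" for X by (intro prod_pos) (use st_bounds in \<open>auto intro!: pmf_bernoulli_pos\<close>)
  have "indicator ?S X \<le> ?f X" for X
    unfolding f using upos[of X] vpos[of X] by (auto simp: indicator_def)
  then have "measure_pmf.expectation ?M (indicator ?S) \<le> measure_pmf.expectation ?M ?f"
    by (intro integral_mono integrable_measure_pmf_finite finite_set_Pi_pmf_bool finA)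
  then show ?thesis unfolding expectation_sqrt_likelihood_ratio by simp
qed

end

text \<open>Le Cam's two-point bound in Hellinger form. Splitting \<open>2 * sqrt (u * v)\<close> by AM-GM with weight
  \<open>B / 2\<close>, where \<open>B\<close> is the total affinity, replaces the Cauchy--Schwarz inequality.\<close>

lemma two_point_bound:
  fixes A :: "'i set" and s t :: "'i \<Rightarrow> real" and p q :: real and g :: "('i \<Rightarrow> bool) \<Rightarrow> real"
  assumes finA: "finite A" and pq: "0 < p" "p < 1" "0 < q" "q < 1"
    and st: "\<And>x. s x \<in> {p, q}" "\<And>x. t x \<in> {p, q}"
    and g: "\<And>X. 0 \<le> g X" "\<And>X. g X \<le> 1"
  shows "affinity p q ^ (2 * card {x \<in> A. s x \<noteq> t x}) / 2 \<le>
    measure_pmf.expectation (Pi_pmf A False (\<lambda>x. bernoulli_pmf (s x))) (\<lambda>X. 1 - g X) +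
    measure_pmf.expectation (Pi_pmf A False (\<lambda>x. bernoulli_pmf (t x))) g"
proof -
  let ?P = "Pi_pmf A False (\<lambda>x. bernoulli_pmf (s x))"
  let ?Q = "Pi_pmf A False (\<lambda>x. bernoulli_pmf (t x))"
  define B where "B = affinity p q ^ card {x \<in> A. s x \<noteq> t x}"
  have Bpos: "B > 0" unfolding B_def using affinity_pos pq by simp
  define F where "F = PiE_dflt A False (\<lambda>_. UNIV :: bool set)"
  have finF: "finite F" unfolding F_def using finA by (intro finite_PiE_dflt) auto
  have PF: "set_pmf ?P \<subseteq> F" "set_pmf ?Q \<subseteq> F"
    using set_Pi_pmf_subset[OF finA, of False "\<lambda>x. bernoulli_pmf (s x)"]
      set_Pi_pmf_subset[OF finA, of False "\<lambda>x. bernoulli_pmf (t x)"]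
    by (simp_all add: F_def PiE_dflt_def)
  have E: "measure_pmf.expectation ?P h = (\<Sum>X\<in>F. h X * pmf ?P X)"
    "measure_pmf.expectation ?Q h = (\<Sum>X\<in>F. h X * pmf ?Q X)" for h :: "_ \<Rightarrow> real"
    using PF finF by (auto intro!: integral_measure_pmf_real)
  have sum1: "(\<Sum>X\<in>F. pmf ?P X) = 1" "(\<Sum>X\<in>F. pmf ?Q X) = 1"
    using PF finF by (auto intro!: sum_pmf_eq_1)
  let ?f = "\<lambda>X. \<Prod>x\<in>A. sqrt (pmf (bernoulli_pmf (t x)) (X x) / pmf (bernoulli_pmf (s x)) (X x))"
  have f: "?f X * pmf ?P X = sqrt (pmf ?P X * pmf ?Q X)" if "X \<in> F" for X
  proof -
    have pmfX: "pmf (Pi_pmf A False r) X = (\<Prod>x\<in>A. pmf (r x) (X x))" for r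
      using that by (intro pmf_Pi' finA) (auto simp: F_def PiE_dflt_def)
    have Ppos: "pmf ?P X > 0" unfolding pmfX
      by (intro prod_pos) (use st_bounds[where s = s and t = t, OF finA subset_refl pq st] in \<open>auto intro!: pmf_bernoulli_pos\<close>)
    have "?f X = sqrt (pmf ?Q X / pmf ?P X)"
      by (simp add: sqrt_prod[symmetric] prod_dividef pmfX)
    then show ?thesis using sqrt_divide_mult[OF Ppos] by simp
  qed
  have "B = (\<Sum>X\<in>F. ?f X * pmf ?P X)"
    using expectation_sqrt_likelihood_ratio[where s = s and t = t and d = False, OF finA subset_refl pq st] unfolding E B_def by simp
  also have "\<dots> = (\<Sum>X\<in>F. sqrt (pmf ?P X * pmf ?Q X))" using f by (intro sum.cong) auto
  finally have B: "B = (\<Sum>X\<in>F. sqrt (pmf ?P X * pmf ?Q X))" .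
  \<comment> \<open>Here \<open>u\<close> and \<open>v\<close> are the two likelihoods and
    \<open>c\<close> is the test. AM-GM is applied to their maximum and minimum: the maximum is at
    most \<open>u + v\<close>, of total mass 2, and the minimum is at most the convex combination
    that sums to the test error.\<close>
  have ptw: "2 * sqrt (u * v) \<le> B / 2 * (u + v) + ((1 - c) * u + c * v) / (B / 2)"
    if "u \<ge> 0" "v \<ge> 0" "0 \<le> c" "c \<le> 1" for u v c :: real
  proof -
    define m M d where "m = min u v" and "M = max u v" and "d = B / 2"
    have mM: "0 \<le> m" "m \<le> u" "m \<le> v" "M \<le> u + v" "0 \<le> M"
      using that by (auto simp: m_def M_def)
    have d: "d > 0" using Bpos by (simp add: d_def)
    have "u * v = m * M" by (auto simp: m_def M_def min_def max_def)
    moreover have "2 * sqrt (m * M) \<le> d * M + m / d"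
    proof -
      have "2 * sqrt ((d * M) * (m / d)) \<le> d * M + m / d"
        using d mM arith_geo_mean_sqrt[of "d * M" "m / d"] by simp
      moreover have "(d * M) * (m / d) = m * M" using d by (simp add: field_simps)
      ultimately show ?thesis by simp
    qed
    moreover have "d * M \<le> d * (u + v)" using d mM by (intro mult_left_mono) auto
    moreover have "m \<le> (1 - c) * u + c * v"
    proof -
      have "m = (1 - c) * m + c * m" by (simp add: algebra_simps)
      also have "\<dots> \<le> (1 - c) * u + c * v" using that mM by (intro add_mono mult_left_mono) auto
      finally show ?thesis .
    qed
    then have "m / d \<le> ((1 - c) * u + c * v) / d" using d by (intro divide_right_mono) auto
    ultimately show ?thesis unfolding d_def by simp
  qed
  let ?R = "(\<Sum>X\<in>F. (1 - g X) * pmf ?P X) + (\<Sum>X\<in>F. g X * pmf ?Q X)"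
  have "2 * B = (\<Sum>X\<in>F. 2 * sqrt (pmf ?P X * pmf ?Q X))" by (subst B) (simp add: sum_distrib_left)
  also have "\<dots> \<le> (\<Sum>X\<in>F. B / 2 * (pmf ?P X + pmf ?Q X)
      + ((1 - g X) * pmf ?P X + g X * pmf ?Q X) / (B / 2))"
    by (intro sum_mono ptw g) auto
  also have "\<dots> = B / 2 * ((\<Sum>X\<in>F. pmf ?P X) + (\<Sum>X\<in>F. pmf ?Q X)) + ?R / (B / 2)"
    by (simp only: sum.distrib sum_distrib_left[symmetric] sum_divide_distrib[symmetric])
  \<comment> \<open>The weight \<open>B / 2\<close> makes the first term equal to \<open>B\<close>,
    half of the left-hand side \<open>2 * B\<close>; what remains gives
    \<open>B^2 / 2 \<le> ?R\<close>.\<close>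
  also have "\<dots> = B + ?R / (B / 2)" by (simp add: sum1)
  finally have "B \<le> ?R / (B / 2)" by simp
  then have "B * (B / 2) \<le> ?R" using Bpos by (simp add: pos_le_divide_eq)
  moreover have "B * B = affinity p q ^ (2 * card {x \<in> A. s x \<noteq> t x})"
    unfolding B_def by (simp add: mult_2 power_add)
  ultimately show ?thesis unfolding E by simp
qed

section \<open>The mechanism\<close>

text \<open>The exponential mechanism with score \<open>- d\<close> on the candidates
  \<open>T\<close>, scaled for scores of sensitivity 1.\<close>

definition exp_mech :: "real \<Rightarrow> 'b set \<Rightarrow> ('b \<Rightarrow> real) \<Rightarrow> 'b pmf" where
  "exp_mech \<epsilon> T d = embed_pmf (\<lambda>x. if x \<in> T then exp (- \<epsilon> * d x / 2) / (\<Sum>y\<in>T. exp (- \<epsilon> * d y / 2)) else 0)"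

context
  fixes T :: "'b set"
  assumes T: "finite T" "T \<noteq> {}"
begin

lemma exp_mech_norm_pos: "0 < (\<Sum>y\<in>T. exp (- \<epsilon> * d y / 2))" for d :: "'b \<Rightarrow> real"
  using T by (intro sum_pos) auto

lemma pmf_exp_mech:
  "pmf (exp_mech \<epsilon> T d) x = (if x \<in> T then exp (- \<epsilon> * d x / 2) / (\<Sum>y\<in>T. exp (- \<epsilon> * d y / 2)) else 0)"
  unfolding exp_mech_def
proof (rule pmf_embed_pmf)
  let ?Z = "\<Sum>y\<in>T. exp (- \<epsilon> * d y / 2)"
  let ?f = "\<lambda>x. if x \<in> T then exp (- \<epsilon> * d x / 2) / ?Z else 0"
  note Z = exp_mech_norm_pos[of \<epsilon> d]
  show "0 \<le> ?f x" for x using Z by simp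
  have "(\<integral>\<^sup>+x. ennreal (?f x) \<partial>count_space UNIV) = (\<Sum>x\<in>T. ennreal (?f x))"
    using T by (intro nn_integral_count_space'[of T]) auto
  also have "\<dots> = ennreal (\<Sum>x\<in>T. ?f x)" using Z by (intro sum_ennreal) auto
  also have "(\<Sum>x\<in>T. ?f x) = (\<Sum>x\<in>T. exp (- \<epsilon> * d x / 2) / ?Z)"
    by (intro sum.cong) auto
  also have "\<dots> = ?Z / ?Z" by (simp only: sum_divide_distrib)
  also have "?Z / ?Z = 1" using Z by (intro divide_self) simp
  finally show "(\<integral>\<^sup>+x. ennreal (?f x) \<partial>count_space UNIV) = 1" by simp
qed

lemma set_exp_mech: "set_pmf (exp_mech \<epsilon> T d) \<subseteq> T"
  by (auto simp: set_pmf_eq pmf_exp_mech split: if_splits)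

lemma prob_exp_mech:
  "measure_pmf.prob (exp_mech \<epsilon> T d) S
   = (\<Sum>x\<in>S \<inter> T. exp (- \<epsilon> * d x / 2)) / (\<Sum>y\<in>T. exp (- \<epsilon> * d y / 2))"
proof -
  have "measure_pmf.prob (exp_mech \<epsilon> T d) S = measure_pmf.prob (exp_mech \<epsilon> T d) (S \<inter> T)"
    by (intro measure_prob_cong_0) (auto simp: pmf_exp_mech)
  also have "\<dots> = (\<Sum>x\<in>S \<inter> T. pmf (exp_mech \<epsilon> T d) x)"
    using T by (intro measure_measure_pmf_finite) auto
  also have "\<dots> = (\<Sum>x\<in>S \<inter> T. exp (- \<epsilon> * d x / 2) / (\<Sum>y\<in>T. exp (- \<epsilon> * d y / 2)))"
    by (intro sum.cong) (auto simp: pmf_exp_mech)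
  finally show ?thesis by (simp add: sum_divide_distrib)
qed

text \<open>Every weight changes by a factor of at most \<open>exp (\<epsilon> / 2)\<close>; this is
  paid once in the numerator and once in the normalising sum.\<close>

lemma exp_mech_private:
  assumes "\<And>x. x \<in> T \<Longrightarrow> \<bar>d x - d' x\<bar> \<le> 1" "\<epsilon> \<ge> 0"
  shows "measure_pmf.prob (exp_mech \<epsilon> T d) S \<le> exp \<epsilon> * measure_pmf.prob (exp_mech \<epsilon> T d') S"
proof -
  have le: "exp (- \<epsilon> * u / 2) \<le> exp (\<epsilon> / 2) * exp (- \<epsilon> * v / 2)" if "\<bar>u - v\<bar> \<le> 1" for u v
  proof -
    have "\<epsilon> * (v - u) \<le> \<epsilon> * 1" using that assms(2) by (intro mult_left_mono) auto
    then have "- \<epsilon> * u / 2 \<le> \<epsilon> / 2 + - \<epsilon> * v / 2" by (simp add: algebra_simps)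
    then show ?thesis unfolding exp_add[symmetric] by simp
  qed
  let ?w = "\<lambda>x. exp (- \<epsilon> * d x / 2)" and ?w' = "\<lambda>x. exp (- \<epsilon> * d' x / 2)"
  have Z: "0 < sum ?w T" "0 < sum ?w' T" by (rule exp_mech_norm_pos)+
  have num: "sum ?w (S \<inter> T) \<le> exp (\<epsilon> / 2) * sum ?w' (S \<inter> T)"
    unfolding sum_distrib_left using assms(1) by (intro sum_mono le) auto
  have den: "sum ?w' T \<le> exp (\<epsilon> / 2) * sum ?w T"
    unfolding sum_distrib_left using assms(1) by (intro sum_mono le) (auto simp: abs_minus_commute)
  have "sum ?w (S \<inter> T) * sum ?w' T \<le> (exp (\<epsilon> / 2) * sum ?w' (S \<inter> T)) * (exp (\<epsilon> / 2) * sum ?w T)"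
    using Z by (intro mult_mono num den mult_nonneg_nonneg sum_nonneg) auto
  also have "\<dots> = (exp (\<epsilon> / 2) * exp (\<epsilon> / 2)) * sum ?w' (S \<inter> T) * sum ?w T"
    by (simp only: mult_ac)
  also have "exp (\<epsilon> / 2) * exp (\<epsilon> / 2) = exp \<epsilon>" by (simp add: exp_add[symmetric])
  finally have "sum ?w (S \<inter> T) * sum ?w' T / (sum ?w T * sum ?w' T)
      \<le> exp \<epsilon> * sum ?w' (S \<inter> T) * sum ?w T / (sum ?w T * sum ?w' T)"
    using Z by (intro divide_right_mono) auto
  moreover have "sum ?w T \<noteq> 0" "sum ?w' T \<noteq> 0" using Z by auto
  ultimately show ?thesis unfolding prob_exp_mech by simp
qed

lemma exp_mech_tail:
  assumes "x0 \<in> T" "d x0 = 0"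
  shows "measure_pmf.prob (exp_mech \<epsilon> T d) S \<le> (\<Sum>x\<in>S \<inter> T. exp (- \<epsilon> * d x / 2))"
proof -
  have "1 = exp (- \<epsilon> * d x0 / 2)" using assms by simp
  also have "\<dots> \<le> (\<Sum>y\<in>T. exp (- \<epsilon> * d y / 2))" using assms T by (intro member_le_sum) auto
  finally have Z: "1 \<le> (\<Sum>y\<in>T. exp (- \<epsilon> * d y / 2))" .
  have "(\<Sum>x\<in>S \<inter> T. exp (- \<epsilon> * d x / 2)) \<ge> 0" by (intro sum_nonneg) auto
  then show ?thesis unfolding prob_exp_mech using Z
      divide_left_mono[of 1 "\<Sum>y\<in>T. exp (- \<epsilon> * d y / 2)" "\<Sum>x\<in>S \<inter> T. exp (- \<epsilon> * d x / 2)"] by simp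
qed

end

section \<open>Node distance to a set of graphs\<close>

definition agree_off :: "nat \<Rightarrow> nat set \<Rightarrow> graph \<Rightarrow> graph \<Rightarrow> bool" where
  "agree_off n V A B \<longleftrightarrow> (\<forall>i\<in>{1..n} - V. \<forall>j\<in>{1..n} - V. A i j = B i j)"

text \<open>The explicit value \<open>n\<close> makes the distance to an empty set of graphs finite.\<close>

definition node_dist :: "nat \<Rightarrow> graph \<Rightarrow> graph set \<Rightarrow> nat" where
  "node_dist n A G = Min (insert n {card V |V. V \<subseteq> {1..n} \<and> (\<exists>B\<in>G. agree_off n V A B)})"

lemma finite_node_dist_set: "finite {card V |V. V \<subseteq> {1..n::nat} \<and> P V}"
  by (rule finite_subset[of _ "card ` Pow {1..n}"]) auto

lemma node_dist_cases:
  obtains "node_dist n A G = n"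
  | V B where "V \<subseteq> {1..n}" "B \<in> G" "agree_off n V A B" "node_dist n A G = card V"
proof -
  have "node_dist n A G \<in> insert n {card V |V. V \<subseteq> {1..n} \<and> (\<exists>B\<in>G. agree_off n V A B)}"
    unfolding node_dist_def using finite_node_dist_set by (intro Min_in) auto
  then show ?thesis using that by auto
qed

lemma node_dist_le:
  "V \<subseteq> {1..n} \<Longrightarrow> B \<in> G \<Longrightarrow> agree_off n V A B \<Longrightarrow> node_dist n A G \<le> card V"
  unfolding node_dist_def using finite_node_dist_set by (intro Min_le) auto

lemma node_dist_le_n: "node_dist n A G \<le> n"
  unfolding node_dist_def using finite_node_dist_set by (intro Min_le) auto

lemma node_dist_eq_0: "A \<in> G \<Longrightarrow> node_dist n A G = 0"
  using node_dist_le[of "{}" n A G A] by (simp add: agree_off_def)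

text \<open>Adding the differing node to an optimal deleted set for \<open>A'\<close> gives an
  admissible one for \<open>A\<close>. The default value \<open>n\<close> is harmless because it
  bounds every distance.\<close>

lemma node_dist_adjacent_le:
  assumes "node_adjacent n A A'"
  shows "node_dist n A G \<le> node_dist n A' G + 1"
proof (cases rule: node_dist_cases[of n A' G])
  case 1
  then show ?thesis using node_dist_le_n[of n A G] by simp
next
  case (2 V B)
  obtain v where v: "v \<in> {1..n}" "\<forall>i\<in>{1..n}. \<forall>j\<in>{1..n}. i \<noteq> v \<longrightarrow> j \<noteq> v \<longrightarrow> A i j = A' i j"
    using assms by (auto simp: node_adjacent_def)
  have "agree_off n (insert v V) A B" using v 2(3) by (auto simp: agree_off_def)
  then have "node_dist n A G \<le> card (insert v V)" using v 2 by (intro node_dist_le) auto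
  also have "\<dots> \<le> card V + 1" using finite_subset[OF 2(1)] by (simp add: card_insert_if)
  finally show ?thesis using 2 by simp
qed

lemma node_adjacent_sym: "node_adjacent n A A' \<Longrightarrow> node_adjacent n A' A"
  unfolding node_adjacent_def by metis

section \<open>Recoverable graphs and the mechanism built on them\<close>

definition likelihood :: "real \<Rightarrow> real \<Rightarrow> (nat \<times> nat) set \<Rightarrow> labeling \<Rightarrow> graph \<Rightarrow> real" where
  "likelihood p q E \<sigma> A =
     (\<Prod>(i, j)\<in>E. pmf (bernoulli_pmf (if \<sigma> i = \<sigma> j then p else q)) (A i j))"

text \<open>Comparing likelihoods on every surviving subgraph makes the evidence for
  \<open>\<sigma>\<close> robust to changes at few nodes. For mismatch 0 no \<open>V\<close>
  qualifies, so relabelings of \<open>\<sigma>\<close> impose nothing.\<close>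

definition recoverable :: "nat \<Rightarrow> nat \<Rightarrow> real \<Rightarrow> real \<Rightarrow> real \<Rightarrow> real \<Rightarrow> labeling \<Rightarrow> graph set" where
  "recoverable n K \<beta> p q c \<sigma> = {A. \<forall>\<tau>\<in>Sigma_beta n K \<beta>. \<forall>V\<subseteq>{1..n}.
     real (card V) < c * real (mismatch n K \<sigma> \<tau>) \<longrightarrow>
     likelihood p q (node_pairs n V) \<tau> A < likelihood p q (node_pairs n V) \<sigma> A}"

lemma likelihood_agree_off:
  "agree_off n V A B \<Longrightarrow> likelihood p q (node_pairs n V) \<sigma> A = likelihood p q (node_pairs n V) \<sigma> B"
  unfolding likelihood_def by (intro prod.cong refl) (auto simp: node_pairs_def agree_off_def)

text \<open>If \<open>A\<close> agreed off a small \<open>V\<close> with a graph recoverable for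
  \<open>\<tau>\<close>, their common subgraph would have to favour strictly both
  \<open>\<sigma>\<close> over \<open>\<tau>\<close> and \<open>\<tau>\<close> over
  \<open>\<sigma>\<close>.\<close>

lemma node_dist_recoverable_ge:
  assumes A: "A \<in> recoverable n K \<beta> p q c \<sigma>" and \<sigma>: "\<sigma> \<in> Sigma_beta n K \<beta>" and \<tau>: "\<tau> \<in> Sigma_beta n K \<beta>"
    and c: "0 < c" "c \<le> 1"
  shows "c * real (mismatch n K \<sigma> \<tau>) \<le> real (node_dist n A (recoverable n K \<beta> p q c \<tau>))"
proof (cases rule: node_dist_cases[of n A "recoverable n K \<beta> p q c \<tau>"])
  case 1
  \<comment> \<open>The default distance \<open>n\<close> is large enough because
    \<open>c \<le> 1\<close>.\<close>
  have "c * real (mismatch n K \<sigma> \<tau>) \<le> 1 * real n"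
    using c mismatch_le_n by (intro mult_mono) auto
  then show ?thesis using 1 by simp
next
  case (2 V B)
  show ?thesis
  proof (rule ccontr)
    assume "\<not> ?thesis"
    then have lt: "real (card V) < c * real (mismatch n K \<sigma> \<tau>)" using 2 by simp
    have "likelihood p q (node_pairs n V) \<tau> A < likelihood p q (node_pairs n V) \<sigma> A"
      using A \<tau> lt 2(1) by (auto simp: recoverable_def)
    moreover have "likelihood p q (node_pairs n V) \<sigma> B < likelihood p q (node_pairs n V) \<tau> B"
      using 2(1,2) \<sigma> lt by (auto simp: recoverable_def mismatch_sym[of n K \<tau> \<sigma>])
    ultimately show False using likelihood_agree_off[OF 2(3)] by simp
  qed
qed

definition recovery_mech :: "nat \<Rightarrow> nat \<Rightarrow> real \<Rightarrow> real \<Rightarrow> real \<Rightarrow> real \<Rightarrow> real \<Rightarrow> graph \<Rightarrow> labeling pmf" where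
  "recovery_mech n K \<beta> p q c \<epsilon> A =
     exp_mech \<epsilon> (Sigma_beta n K \<beta>) (\<lambda>\<tau>. real (node_dist n A (recoverable n K \<beta> p q c \<tau>)))"

lemma Sigma_beta_subset: "Sigma_beta n K \<beta> \<subseteq> labelings n K"
  by (auto simp: Sigma_beta_def)

lemma finite_Sigma_beta [simp]: "finite (Sigma_beta n K \<beta>)"
  using Sigma_beta_subset finite_labelings by (rule finite_subset)

lemma node_DP_recovery_mech:
  assumes "Sigma_beta n K \<beta> \<noteq> {}" "\<epsilon> \<ge> 0"
  shows "node_DP n K \<epsilon> (recovery_mech n K \<beta> p q c \<epsilon>)"
  unfolding node_DP_def
proof (intro conjI ballI impI allI)
  fix A assume "A \<in> graphs n"
  show "set_pmf (recovery_mech n K \<beta> p q c \<epsilon> A) \<subseteq> labelings n K"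
    using set_exp_mech[of "Sigma_beta n K \<beta>"] assms Sigma_beta_subset
    unfolding recovery_mech_def by (meson finite_Sigma_beta order.trans)
next
  fix A A' :: graph and S assume adj: "node_adjacent n A A'"
  have "\<bar>real (node_dist n A G) - real (node_dist n A' G)\<bar> \<le> 1" for G
    using node_dist_adjacent_le[OF adj, of G] node_dist_adjacent_le[OF node_adjacent_sym[OF adj], of G]
    by linarith
  then show "measure_pmf.prob (recovery_mech n K \<beta> p q c \<epsilon> A) S
      \<le> exp \<epsilon> * measure_pmf.prob (recovery_mech n K \<beta> p q c \<epsilon> A') S"
    unfolding recovery_mech_def using assms by (intro exp_mech_private) auto
qed

text \<open>Each labeling is charged to the relabelings that realise its mismatch, at the price of a factor \<open>K!\<close>.\<close>

lemma sum_power_mismatch_le: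
  fixes x :: real
  assumes "\<sigma> \<in> labelings n K" "x \<ge> 0" "real n * (real K * x) \<le> 1"
  shows "(\<Sum>\<tau>\<in>{\<tau> \<in> labelings n K. mismatch n K \<sigma> \<tau> \<noteq> 0}. x ^ mismatch n K \<sigma> \<tau>)
    \<le> 2 * fact K * (real n * (real K * x))"
proof -
  let ?L = "{\<tau> \<in> labelings n K. mismatch n K \<sigma> \<tau> \<noteq> 0}"
  let ?P = "{\<pi>. \<pi> permutes {1..K}}"
  let ?r = "\<lambda>\<pi> \<tau>. restrict (\<pi> \<circ> \<tau>) {1..n}"
  have ham: "hamming n \<sigma> (?r \<pi> \<tau>) = hamming n \<sigma> (\<pi> \<circ> \<tau>)" for \<pi> \<tau>
    unfolding hamming_def by (intro arg_cong[of _ _ card]) auto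
  have "x ^ mismatch n K \<sigma> \<tau> \<le> (\<Sum>\<pi>\<in>?P. x ^ hamming n \<sigma> (?r \<pi> \<tau>))" for \<tau>
  proof -
    obtain \<pi> where \<pi>: "\<pi> permutes {1..K}" "hamming n \<sigma> (\<pi> \<circ> \<tau>) = mismatch n K \<sigma> \<tau>"
      by (rule mismatch_obtain)
    have "x ^ mismatch n K \<sigma> \<tau> = x ^ hamming n \<sigma> (?r \<pi> \<tau>)" by (simp only: ham \<pi>)
    also have "\<dots> \<le> (\<Sum>\<pi>\<in>?P. x ^ hamming n \<sigma> (?r \<pi> \<tau>))"
      using \<pi>(1) assms(2) finite_permutes[of K] by (intro member_le_sum) auto
    finally show ?thesis .
  qed
  then have "(\<Sum>\<tau>\<in>?L. x ^ mismatch n K \<sigma> \<tau>) \<le> (\<Sum>\<tau>\<in>?L. \<Sum>\<pi>\<in>?P. x ^ hamming n \<sigma> (?r \<pi> \<tau>))"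
    by (intro sum_mono)
  also have "\<dots> = (\<Sum>\<pi>\<in>?P. \<Sum>\<tau>\<in>?L. x ^ hamming n \<sigma> (?r \<pi> \<tau>))"
    by (rule sum.swap)
  also have "\<dots> \<le> (\<Sum>\<pi>\<in>?P. 2 * (real n * (real K * x)))"
  proof (intro sum_mono)
    fix \<pi> assume "\<pi> \<in> ?P"
    then have \<pi>: "\<pi> permutes {1..K}" by simp
    \<comment> \<open>For a fixed relabeling, \<open>?r \<pi>\<close> is injective and never yields
      \<open>\<sigma>\<close>, since a labeling sent to \<open>\<sigma>\<close> has mismatch 0. The
      inner sum is therefore part of the Hamming sum.\<close>
    have inj: "inj_on (?r \<pi>) ?L"
    proof (intro inj_onI)
      fix \<tau> \<tau>' assume t: "\<tau> \<in> ?L" "\<tau>' \<in> ?L" and eq: "?r \<pi> \<tau> = ?r \<pi> \<tau>'"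
      have "\<tau> i = \<tau>' i" if "i \<in> {1..n}" for i
        using fun_cong[OF eq, of i] that permutes_inj[OF \<pi>] by (auto dest: injD)
      then show "\<tau> = \<tau>'" using t unfolding labelings_def by (auto intro: PiE_ext)
    qed
    have "?r \<pi> \<tau> \<in> labelings n K - {\<sigma>}" if "\<tau> \<in> ?L" for \<tau>
    proof -
      have "?r \<pi> \<tau> \<noteq> \<sigma>"
      proof
        assume eq: "?r \<pi> \<tau> = \<sigma>"
        have "hamming n \<sigma> (?r \<pi> \<tau>) = 0" unfolding eq by (simp add: hamming_def)
        then show False using mismatch_le[OF \<pi>, of n \<sigma> \<tau>] that ham[of \<pi> \<tau>] by simp
      qed
      then show ?thesis using permutes_labelings[OF \<pi>] that by auto
    qed
    then have "?r \<pi> ` ?L \<subseteq> labelings n K - {\<sigma>}" by blast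
    moreover have "(\<Sum>\<tau>\<in>?L. x ^ hamming n \<sigma> (?r \<pi> \<tau>)) = (\<Sum>\<tau>\<in>?r \<pi> ` ?L. x ^ hamming n \<sigma> \<tau>)"
      by (subst sum.reindex[OF inj]) (simp only: o_def)
    ultimately have "(\<Sum>\<tau>\<in>?L. x ^ hamming n \<sigma> (?r \<pi> \<tau>)) \<le> (\<Sum>\<tau>\<in>labelings n K - {\<sigma>}. x ^ hamming n \<sigma> \<tau>)"
      using assms(2) sum_mono2[of "labelings n K - {\<sigma>}" "?r \<pi> ` ?L" "\<lambda>\<tau>. x ^ hamming n \<sigma> \<tau>"]
      by (simp only: finite_Diff finite_labelings zero_le_power)
    also have "\<dots> \<le> 2 * (real n * (real K * x))" by (rule sum_power_hamming_le[OF assms])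
    finally show "(\<Sum>\<tau>\<in>?L. x ^ hamming n \<sigma> (?r \<pi> \<tau>)) \<le> 2 * (real n * (real K * x))" .
  qed
  also have "\<dots> = 2 * fact K * (real n * (real K * x))"
  proof -
    have "card ?P = fact K" by (rule card_permutations) auto
    then show ?thesis by (simp only: sum_constant of_nat_fact mult_ac)
  qed
  finally show ?thesis .
qed

text \<open>The truth \<open>\<sigma>\<close> has distance 0, while a labeling at mismatch
  \<open>m\<close> has distance at least \<open>c m\<close> and hence weight at most the
  \<open>m\<close>-th power of \<open>exp (- \<epsilon> * c / 2)\<close>.\<close>

lemma recovery_mech_error:
  assumes A: "A \<in> recoverable n K \<beta> p q c \<sigma>" and \<sigma>: "\<sigma> \<in> Sigma_beta n K \<beta>"
    and c: "0 < c" "c \<le> 1" and "\<epsilon> \<ge> 0" and small: "real n * (real K * exp (- \<epsilon> * c / 2)) \<le> 1"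
  shows "measure_pmf.prob (recovery_mech n K \<beta> p q c \<epsilon> A) {\<tau>. mismatch n K \<sigma> \<tau> \<noteq> 0}
    \<le> 2 * fact K * (real n * (real K * exp (- \<epsilon> * c / 2)))"
proof -
  let ?d = "\<lambda>\<tau>. real (node_dist n A (recoverable n K \<beta> p q c \<tau>))"
  let ?S = "{\<tau>. mismatch n K \<sigma> \<tau> \<noteq> 0}" and ?y = "exp (- \<epsilon> * c / 2)"
  have "measure_pmf.prob (recovery_mech n K \<beta> p q c \<epsilon> A) ?S
      \<le> (\<Sum>\<tau>\<in>?S \<inter> Sigma_beta n K \<beta>. exp (- \<epsilon> * ?d \<tau> / 2))"
    unfolding recovery_mech_def using \<sigma> node_dist_eq_0[OF A] by (intro exp_mech_tail[of _ \<sigma>]) auto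
  also have "\<dots> \<le> (\<Sum>\<tau>\<in>?S \<inter> Sigma_beta n K \<beta>. ?y ^ mismatch n K \<sigma> \<tau>)"
  proof (intro sum_mono)
    fix \<tau> assume "\<tau> \<in> ?S \<inter> Sigma_beta n K \<beta>"
    then have "\<epsilon> * (c * real (mismatch n K \<sigma> \<tau>)) \<le> \<epsilon> * ?d \<tau>"
      using node_dist_recoverable_ge[OF A \<sigma> _ c] \<open>\<epsilon> \<ge> 0\<close> by (intro mult_left_mono) auto
    then show "exp (- \<epsilon> * ?d \<tau> / 2) \<le> ?y ^ mismatch n K \<sigma> \<tau>"
      unfolding exp_of_nat_mult[symmetric] by (simp add: algebra_simps)
  qed
  also have "\<dots> \<le> (\<Sum>\<tau>\<in>{\<tau> \<in> labelings n K. mismatch n K \<sigma> \<tau> \<noteq> 0}. ?y ^ mismatch n K \<sigma> \<tau>)"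
    using Sigma_beta_subset by (intro sum_mono2) auto
  also have "\<dots> \<le> 2 * fact K * (real n * (real K * ?y))"
    using \<sigma> Sigma_beta_subset small by (intro sum_power_mismatch_le) auto
  finally show ?thesis .
qed

section \<open>Upper bound on the risk\<close>

definition symmetrise :: "(nat \<times> nat \<Rightarrow> bool) \<Rightarrow> graph" where
  "symmetrise X = (\<lambda>i j. X (min i j, max i j))"

definition edge_prob :: "real \<Rightarrow> real \<Rightarrow> labeling \<Rightarrow> nat \<times> nat \<Rightarrow> real" where
  "edge_prob p q \<sigma> = (\<lambda>(i, j). if \<sigma> i = \<sigma> j then p else q)"

definition edge_pmf :: "nat \<Rightarrow> real \<Rightarrow> real \<Rightarrow> labeling \<Rightarrow> (nat \<times> nat \<Rightarrow> bool) pmf" where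
  "edge_pmf n p q \<sigma> = Pi_pmf (node_pairs n {}) False (\<lambda>x. bernoulli_pmf (edge_prob p q \<sigma> x))"

text \<open>Moves the model to a product law indexed by the pairs \<open>i < j\<close>, where the
  testing bounds apply.\<close>

lemma SBM_eq: "SBM n a b \<sigma> = map_pmf symmetrise (edge_pmf n (a / real n) (b / real n) \<sigma>)"
  unfolding SBM_def edge_pmf_def symmetrise_def[abs_def] node_pairs_def edge_prob_def
  by (intro arg_cong2[of _ _ _ _ map_pmf] Pi_pmf_cong refl) auto

lemma likelihood_symmetrise:
  "likelihood p q (node_pairs n V) \<sigma> (symmetrise X)
   = (\<Prod>x\<in>node_pairs n V. pmf (bernoulli_pmf (edge_prob p q \<sigma> x)) (X x))"
  unfolding likelihood_def
  by (intro prod.cong refl) (auto simp: node_pairs_def symmetrise_def edge_prob_def min_def max_def)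

lemma disagree_edge_prob:
  "p \<noteq> q \<Longrightarrow> {x \<in> node_pairs n V. edge_prob p q \<sigma> x \<noteq> edge_prob p q \<tau> x} = disagree n V \<sigma> \<tau>"
  by (auto simp: disagree_def edge_prob_def split: if_splits)

lemma node_pairs_mono: "node_pairs n V \<subseteq> node_pairs n {}"
  by (auto simp: node_pairs_def)

text \<open>Each disagreement pair thus contributes a factor \<open>exp (- I / 2)\<close> to the
  error bound of a likelihood test.\<close>

lemma affinity_SBM_info:
  assumes "0 < b" "b < a" "a < real n"
  shows "affinity (a / real n) (b / real n) = exp (- SBM_info n a b / 2)"
proof -
  have "affinity (a / real n) (b / real n) > 0"
    using assms by (intro affinity_pos) auto
  then show ?thesis by (simp add: SBM_info_def affinity_def)
qed

lemma Sigma_beta_sizes: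
  assumes "\<sigma> \<in> Sigma_beta n K \<beta>" "k \<in> {1..K}"
  shows "real n / (\<beta> * real K) \<le> real (card {i \<in> {1..n}. \<sigma> i = k})"
  using assms by (auto simp: Sigma_beta_def)

text \<open>Deleting fewer than \<open>c * m\<close> nodes destroys at most \<open>c m n\<close> of the pairs on which two labelings
  disagree, hence at most half of them for \<open>c = 1 / (8 \<beta> \<kappa>)\<close> with \<open>\<kappa> \<ge> K\<close>.\<close>

lemma signal_le_disagree:
  assumes \<sigma>: "\<sigma> \<in> Sigma_beta n K \<beta>" and \<tau>: "\<tau> \<in> Sigma_beta n K \<beta>"
    and K: "2 \<le> K" "real K \<le> \<kappa>" and \<beta>: "1 \<le> \<beta>" and V: "V \<subseteq> {1..n}"
    and small: "real (card V) < 1 / (8 * \<beta> * \<kappa>) * real (mismatch n K \<sigma> \<tau>)"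
    and I: "0 \<le> SBM_info n a b"
  shows "Signal n K a b \<beta> / 16 * real (mismatch n K \<sigma> \<tau>)
    \<le> real (card (disagree n V \<sigma> \<tau>)) * (SBM_info n a b / 2)"
proof -
  let ?m = "real (mismatch n K \<sigma> \<tau>)" and ?I = "SBM_info n a b"
  let ?N = "real (card (disagree n V \<sigma> \<tau>))" and ?Nall = "real (card (disagree n {} \<sigma> \<tau>))"
  have lab: "\<sigma> \<in> labelings n K" "\<tau> \<in> labelings n K"
    using \<sigma> \<tau> Sigma_beta_subset by auto
  have "1 / (8 * \<beta> * \<kappa>) \<le> 1 / (8 * \<beta> * real K)"
    using K \<beta> by (intro divide_left_mono mult_left_mono) auto
  then have "1 / (8 * \<beta> * \<kappa>) * ?m \<le> 1 / (8 * \<beta> * real K) * ?m" by (intro mult_right_mono) auto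
  then have V': "real (card V) \<le> 1 / (8 * \<beta> * real K) * ?m" using small by linarith
  \<comment> \<open>An upper bound for the number of pairs lost to deletion.\<close>
  define \<delta> where "\<delta> = 1 / (8 * \<beta> * real K) * ?m * real n"
  have "real (card V) * real n \<le> \<delta>"
    unfolding \<delta>_def using V' by (intro mult_right_mono) auto
  moreover have "?Nall \<le> ?N + real (card V) * real n"
    unfolding of_nat_mult[symmetric] of_nat_add[symmetric] of_nat_le_iff
    by (rule card_disagree_restrict[OF V])
  ultimately have N: "?Nall - \<delta> \<le> ?N" by linarith
  show ?thesis
  proof (cases "K = 2")
    case True
    \<comment> \<open>For two communities \<open>Signal\<close> contains no \<open>\<beta>\<close>,
      so the count must be free of it too. The lost pairs are at most an eighth of the guaranteed
      \<open>n m / 2\<close>.\<close>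
    have "real (n * mismatch n K \<sigma> \<tau>) \<le> real (2 * card (disagree n {} \<sigma> \<tau>))"
      using card_disagree_ge_two[of \<sigma> n \<tau>] lab unfolding True of_nat_le_iff by blast
    then have "real n * ?m \<le> 2 * ?Nall" by simp
    moreover have "1 / (8 * \<beta> * real K) * (?m * real n) \<le> 1 / 16 * (?m * real n)"
      using True \<beta> by (intro mult_right_mono) (auto simp: field_simps)
    then have "\<delta> \<le> real n * ?m / 16" unfolding \<delta>_def by (simp only: mult_ac)
    moreover have "0 \<le> real n * ?m" by simp
    ultimately have "real n * ?m / 16 \<le> ?N" using N by linarith
    then have "real n * ?m / 16 * (?I / 2) \<le> ?N * (?I / 2)" using I by (intro mult_right_mono) auto
    then show ?thesis using True by (simp add: Signal_def mult_ac)
  next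
    case False
    \<comment> \<open>Here \<open>n m / (4 \<beta> K)\<close> pairs are guaranteed, and
      \<open>\<delta>\<close> is half of that.\<close>
    have "real n / (\<beta> * real K) * ?m \<le> 4 * ?Nall"
      using \<sigma> \<tau> \<beta> by (intro card_disagree_ge lab Sigma_beta_sizes) auto
    moreover have "\<delta> = (real n / (\<beta> * real K) * ?m) / 8"
      by (simp add: \<delta>_def mult_ac)
    ultimately have "real n / (\<beta> * real K) * ?m / 8 \<le> ?N" using N by linarith
    then have "real n / (\<beta> * real K) * ?m / 8 * (?I / 2) \<le> ?N * (?I / 2)"
      using I by (intro mult_right_mono) auto
    then show ?thesis using False by (simp add: Signal_def mult_ac)
  qed
qed

text \<open>Give a subset of size \<open>k\<close> the weight \<open>n^m / n^k\<close>, which is at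
  least 1 on the sets counted. Over all subsets the weights sum to
  \<open>n^m (1 + 1 / n)^n\<close>.\<close>

lemma card_small_subsets_le:
  assumes "n \<ge> 1"
  shows "real (card {V. V \<subseteq> {1..n} \<and> card V \<le> m}) \<le> 3 * real n ^ m"
proof -
  let ?W = "{V. V \<subseteq> {1..n} \<and> card V \<le> m}"
  have n: "real n > 0" using assms by simp
  have fin: "finite ?W" by (rule finite_subset[of _ "Pow {1..n}"]) auto
  have "real (card ?W) = (\<Sum>V\<in>?W. 1)" by simp
  also have "\<dots> \<le> (\<Sum>V\<in>?W. real n ^ m * (1 / real n) ^ card V)"
  proof (intro sum_mono)
    fix V assume "V \<in> ?W"
    then have "real n ^ card V \<le> real n ^ m" using assms by (intro power_increasing) auto
    then show "1 \<le> real n ^ m * (1 / real n) ^ card V"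
      using n by (simp add: power_one_over field_simps)
  qed
  also have "\<dots> \<le> (\<Sum>V\<in>Pow {1..n}. real n ^ m * (1 / real n) ^ card V)"
    by (intro sum_mono2) auto
  also have "\<dots> = real n ^ m * (\<Sum>V\<in>Pow {1..n}. (1 / real n) ^ card V)"
    by (simp add: sum_distrib_left)
  also have "\<dots> \<le> real n ^ m * 3"
  proof (intro mult_left_mono)
    have "(\<Sum>V\<in>Pow {1..n}. (1 / real n) ^ card V) = (1 / real n + 1) ^ n"
      using prod_add[of "{1..n}" "\<lambda>_. 1 / real n" "\<lambda>_. 1"] by simp
    also have "\<dots> \<le> exp (1 / real n) ^ n"
      using exp_ge_add_one_self[of "1 / real n"] by (intro power_mono) (auto simp: add.commute)
    also have "\<dots> = exp 1" using n by (simp add: exp_of_nat_mult[symmetric])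
    also have "\<dots> \<le> 3" by (rule exp_le)
    finally show "(\<Sum>V\<in>Pow {1..n}. (1 / real n) ^ card V) \<le> 3" .
  qed simp
  finally show ?thesis by (simp only: mult.commute)
qed

text \<open>Union bound over rival labelings and deleted sets. At mismatch \<open>m\<close> each
  test errs with probability at most the \<open>m\<close>-th power of
  \<open>exp (- Signal / 16)\<close>; there are at most \<open>3 n^m\<close> deleted sets, and
  \<open>n^m\<close> is absorbed into \<open>x^m\<close>.\<close>

lemma not_recoverable_prob_le:
  fixes n K :: nat and a b \<beta> \<kappa> :: real
  defines "p \<equiv> a / real n" and "q \<equiv> b / real n" and "c \<equiv> 1 / (8 * \<beta> * \<kappa>)"
    and "x \<equiv> real n * exp (- Signal n K a b \<beta> / 16)"
  assumes \<sigma>: "\<sigma> \<in> Sigma_beta n K \<beta>" and K: "2 \<le> K" "real K \<le> \<kappa>" and \<beta>: "1 \<le> \<beta>"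
    and ab: "0 < b" "b < a" "a < real n" and I: "0 \<le> SBM_info n a b"
    and small: "real n * (real K * x) \<le> 1"
  shows "measure_pmf.prob (edge_pmf n p q \<sigma>) {X. symmetrise X \<notin> recoverable n K \<beta> p q c \<sigma>}
    \<le> 6 * fact K * (real n * (real K * x))"
proof -
  let ?P = "edge_pmf n p q \<sigma>" and ?S = "Signal n K a b \<beta>"
  let ?L = "{\<tau> \<in> Sigma_beta n K \<beta>. mismatch n K \<sigma> \<tau> \<noteq> 0}"
  let ?W = "\<lambda>\<tau>. {V. V \<subseteq> {1..n} \<and> real (card V) < c * real (mismatch n K \<sigma> \<tau>)}"
  let ?Ev = "\<lambda>\<tau> V. {X. likelihood p q (node_pairs n V) \<sigma> (symmetrise X)
    \<le> likelihood p q (node_pairs n V) \<tau> (symmetrise X)}"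
  have n: "n \<ge> 1" using ab by (cases n) auto
  have pq: "0 < p" "p < 1" "0 < q" "q < 1" "p \<noteq> q" using ab n by (auto simp: p_def q_def)
  have finW: "finite (?W \<tau>)" for \<tau> by (rule finite_subset[of _ "Pow {1..n}"]) auto
  \<comment> \<open>Ensures that an admissible deleted set has at most as many nodes as the
    mismatch.\<close>
  have c1: "c \<le> 1"
  proof -
    have "1 * 2 \<le> \<beta> * \<kappa>" using K \<beta> by (intro mult_mono) auto
    then show ?thesis by (simp add: c_def field_simps)
  qed
  have Ev: "measure_pmf.prob ?P (?Ev \<tau> V) \<le> exp (- ?S / 16) ^ mismatch n K \<sigma> \<tau>"
    if "\<tau> \<in> ?L" "V \<in> ?W \<tau>" for \<tau> V
  proof -
    have "measure_pmf.prob ?P (?Ev \<tau> V) \<le> affinity p q ^ card (disagree n V \<sigma> \<tau>)"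
      unfolding likelihood_symmetrise edge_pmf_def disagree_edge_prob[OF pq(5), symmetric]
      by (rule likelihood_test_error[OF finite_node_pairs node_pairs_mono pq(1-4)])
        (auto simp: edge_prob_def split: prod.splits)
    also have "\<dots> = exp (- (real (card (disagree n V \<sigma> \<tau>)) * (SBM_info n a b / 2)))"
      unfolding p_def q_def affinity_SBM_info[OF ab] exp_of_nat_mult[symmetric] by simp
    also have "\<dots> \<le> exp (- (?S / 16 * real (mismatch n K \<sigma> \<tau>)))"
      using signal_le_disagree[OF \<sigma> _ K \<beta> _ _ I, of \<tau> V] that by (simp add: c_def)
    also have "\<dots> = exp (- ?S / 16) ^ mismatch n K \<sigma> \<tau>"
      unfolding exp_of_nat_mult[symmetric] by (simp add: mult.commute)
    finally show ?thesis .
  qed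
  have "{X. symmetrise X \<notin> recoverable n K \<beta> p q c \<sigma>} \<subseteq> (\<Union>\<tau>\<in>?L. \<Union>V\<in>?W \<tau>. ?Ev \<tau> V)"
  proof
    fix X assume "X \<in> {X. symmetrise X \<notin> recoverable n K \<beta> p q c \<sigma>}"
    then obtain \<tau> V where tV: "\<tau> \<in> Sigma_beta n K \<beta>" "V \<in> ?W \<tau>" "X \<in> ?Ev \<tau> V"
      by (auto simp: recoverable_def not_less)
    then have "mismatch n K \<sigma> \<tau> \<noteq> 0" by (intro notI) simp
    then show "X \<in> (\<Union>\<tau>\<in>?L. \<Union>V\<in>?W \<tau>. ?Ev \<tau> V)" using tV by blast
  qed
  then have "measure_pmf.prob ?P {X. symmetrise X \<notin> recoverable n K \<beta> p q c \<sigma>}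
      \<le> measure_pmf.prob ?P (\<Union>\<tau>\<in>?L. \<Union>V\<in>?W \<tau>. ?Ev \<tau> V)"
    by (intro measure_pmf.finite_measure_mono) auto
  also have "\<dots> \<le> (\<Sum>\<tau>\<in>?L. measure_pmf.prob ?P (\<Union>V\<in>?W \<tau>. ?Ev \<tau> V))"
    by (intro measure_pmf.finite_measure_subadditive_finite) auto
  also have "\<dots> \<le> (\<Sum>\<tau>\<in>?L. \<Sum>V\<in>?W \<tau>. measure_pmf.prob ?P (?Ev \<tau> V))"
    using finW by (intro sum_mono measure_pmf.finite_measure_subadditive_finite) auto
  also have "\<dots> \<le> (\<Sum>\<tau>\<in>?L. \<Sum>V\<in>?W \<tau>. exp (- ?S / 16) ^ mismatch n K \<sigma> \<tau>)"
    using Ev by (intro sum_mono) auto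
  also have "\<dots> \<le> (\<Sum>\<tau>\<in>?L. 3 * x ^ mismatch n K \<sigma> \<tau>)"
  proof (intro sum_mono)
    fix \<tau> assume "\<tau> \<in> ?L"
    let ?m = "mismatch n K \<sigma> \<tau>"
    have "?W \<tau> \<subseteq> {V. V \<subseteq> {1..n} \<and> card V \<le> ?m}"
    proof
      fix V assume V: "V \<in> ?W \<tau>"
      have "c * real ?m \<le> 1 * real ?m" using c1 by (intro mult_right_mono) auto
      then show "V \<in> {V. V \<subseteq> {1..n} \<and> card V \<le> ?m}" using V by auto
    qed
    then have "card (?W \<tau>) \<le> card {V. V \<subseteq> {1..n} \<and> card V \<le> ?m}"
      by (intro card_mono finite_subset[of "{V. V \<subseteq> {1..n} \<and> card V \<le> ?m}" "Pow {1..n}"]) auto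
    then have "real (card (?W \<tau>)) \<le> 3 * real n ^ ?m"
      using card_small_subsets_le[OF n, of ?m] by linarith
    then have "real (card (?W \<tau>)) * exp (- ?S / 16) ^ ?m \<le> 3 * real n ^ ?m * exp (- ?S / 16) ^ ?m"
      by (intro mult_right_mono) auto
    then show "(\<Sum>V\<in>?W \<tau>. exp (- ?S / 16) ^ ?m) \<le> 3 * x ^ ?m"
      by (simp add: x_def power_mult_distrib)
  qed
  also have "\<dots> = 3 * (\<Sum>\<tau>\<in>?L. x ^ mismatch n K \<sigma> \<tau>)" by (simp add: sum_distrib_left)
  also have "\<dots> \<le> 3 * (\<Sum>\<tau>\<in>{\<tau> \<in> labelings n K. mismatch n K \<sigma> \<tau> \<noteq> 0}. x ^ mismatch n K \<sigma> \<tau>)"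
    using Sigma_beta_subset[of n K \<beta>] by (intro mult_left_mono sum_mono2) (auto simp: x_def)
  also have "\<dots> \<le> 3 * (2 * fact K * (real n * (real K * x)))"
    using \<sigma> Sigma_beta_subset small by (intro mult_left_mono sum_power_mismatch_le) (auto simp: x_def)
  finally show ?thesis by simp
qed

section \<open>Risk and the probability of imperfect recovery\<close>

lemma loss_nonneg: "0 \<le> loss n K \<sigma> \<tau>"
  by (simp add: loss_eq)

lemma loss_le_1: "loss n K \<sigma> \<tau> \<le> 1"
  using mismatch_le_n[of n K \<sigma> \<tau>] by (cases "n = 0") (auto simp: loss_eq)

lemma integrable_loss: "integrable (measure_pmf P) (\<lambda>\<tau>. loss n K \<sigma> \<tau>)"
  by (rule measure_pmf.integrable_const_bound[of _ 1]) (use loss_nonneg loss_le_1 in auto)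

lemma integrable_prob: "integrable (measure_pmf P) (\<lambda>X. measure_pmf.prob (M X) S)"
  by (rule measure_pmf.integrable_const_bound[of _ 1]) auto

lemma prob_bind_pmf:
  "measure_pmf.prob (bind_pmf P M) S = measure_pmf.expectation P (\<lambda>X. measure_pmf.prob (M X) S)"
proof -
  have "ennreal (measure_pmf.prob (bind_pmf P M) S) = (\<integral>\<^sup>+X. ennreal (measure_pmf.prob (M X) S) \<partial>measure_pmf P)"
    by (simp add: measure_pmf.emeasure_eq_measure[symmetric])
  also have "\<dots> = ennreal (measure_pmf.expectation P (\<lambda>X. measure_pmf.prob (M X) S))"
    by (intro nn_integral_eq_integral integrable_prob) auto
  finally show ?thesis by (simp add: integral_nonneg)
qed

text \<open>The loss vanishes off \<open>S\<close> and lies between \<open>1 / n\<close> and 1 on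
  it, so up to a factor \<open>n\<close> the risk is the probability of missing the true
  partition.\<close>

lemma risk_bounds:
  fixes n K :: nat and a b :: real and \<sigma>\<^sub>0 :: labeling
  defines "S \<equiv> {\<tau>. mismatch n K \<sigma>\<^sub>0 \<tau> \<noteq> 0}"
  defines "P \<equiv> edge_pmf n (a / real n) (b / real n) \<sigma>\<^sub>0"
  shows "risk n K a b M \<sigma>\<^sub>0 \<le> measure_pmf.expectation P (\<lambda>X. measure_pmf.prob (M (symmetrise X)) S)"
    and "measure_pmf.expectation P (\<lambda>X. measure_pmf.prob (M (symmetrise X)) S) \<le> real n * risk n K a b M \<sigma>\<^sub>0"
    and "0 \<le> risk n K a b M \<sigma>\<^sub>0" and "risk n K a b M \<sigma>\<^sub>0 \<le> 1"
proof -
  let ?R = "bind_pmf P (\<lambda>X. M (symmetrise X))"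
  have risk: "risk n K a b M \<sigma>\<^sub>0 = measure_pmf.expectation ?R (loss n K \<sigma>\<^sub>0)"
    by (simp add: risk_def SBM_eq P_def bind_map_pmf)
  have "risk n K a b M \<sigma>\<^sub>0 \<le> measure_pmf.expectation ?R (indicator S)"
    unfolding risk using loss_le_1[of n K \<sigma>\<^sub>0]
    by (intro integral_mono integrable_loss) (auto simp: S_def indicator_def loss_eq measure_pmf.emeasure_eq_measure)
  then show "risk n K a b M \<sigma>\<^sub>0 \<le> measure_pmf.expectation P (\<lambda>X. measure_pmf.prob (M (symmetrise X)) S)"
    by (simp add: prob_bind_pmf)
  have "measure_pmf.expectation ?R (indicator S) \<le> measure_pmf.expectation ?R (\<lambda>\<tau>. real n * loss n K \<sigma>\<^sub>0 \<tau>)"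
  proof (intro integral_mono integrable_mult_right integrable_loss)
    fix \<tau>
    show "indicator S \<tau> \<le> real n * loss n K \<sigma>\<^sub>0 \<tau>"
      using mismatch_le_n[of n K \<sigma>\<^sub>0 \<tau>]
      by (cases "n = 0") (auto simp: S_def indicator_def loss_eq)
  qed (auto simp: measure_pmf.emeasure_eq_measure)
  then show "measure_pmf.expectation P (\<lambda>X. measure_pmf.prob (M (symmetrise X)) S) \<le> real n * risk n K a b M \<sigma>\<^sub>0"
    by (simp add: prob_bind_pmf risk)
  show "0 \<le> risk n K a b M \<sigma>\<^sub>0" unfolding risk by (intro Bochner_Integration.integral_nonneg) (simp add: loss_nonneg)
  have "risk n K a b M \<sigma>\<^sub>0 \<le> measure_pmf.expectation ?R (\<lambda>_. 1)"
    unfolding risk by (intro integral_mono integrable_loss) (auto simp: loss_le_1)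
  then show "risk n K a b M \<sigma>\<^sub>0 \<le> 1" by simp
qed

text \<open>Split on whether the sample is recoverable: if not, the error probability is bounded by
  1, otherwise by the tail of the mechanism.\<close>

lemma risk_recovery_mech_le:
  fixes n K :: nat and a b \<beta> \<kappa> \<epsilon> :: real
  defines "p \<equiv> a / real n" and "q \<equiv> b / real n" and "c \<equiv> 1 / (8 * \<beta> * \<kappa>)"
    and "x \<equiv> real n * exp (- Signal n K a b \<beta> / 16)" and "y \<equiv> exp (- \<epsilon> * (1 / (8 * \<beta> * \<kappa>)) / 2)"
  assumes \<sigma>: "\<sigma> \<in> Sigma_beta n K \<beta>" and K: "2 \<le> K" "real K \<le> \<kappa>" and \<beta>: "1 \<le> \<beta>"
    and ab: "0 < b" "b < a" "a < real n" and I: "0 \<le> SBM_info n a b"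
    and small: "real n * (real K * x) \<le> 1" and "\<epsilon> \<ge> 0" and small': "real n * (real K * y) \<le> 1"
  shows "risk n K a b (recovery_mech n K \<beta> p q c \<epsilon>) \<sigma>
    \<le> 6 * fact K * (real n * (real K * x)) + 2 * fact K * (real n * (real K * y))"
proof -
  let ?P = "edge_pmf n p q \<sigma>" and ?M = "recovery_mech n K \<beta> p q c \<epsilon>"
  let ?S = "{\<tau>. mismatch n K \<sigma> \<tau> \<noteq> 0}" and ?B = "{X. symmetrise X \<notin> recoverable n K \<beta> p q c \<sigma>}"
  let ?t = "2 * fact K * (real n * (real K * y))"
  have c: "0 < c" "c \<le> 1"
  proof -
    have "1 * 2 \<le> \<beta> * \<kappa>" using K \<beta> by (intro mult_mono) auto
    then show "0 < c" "c \<le> 1" by (auto simp: c_def field_simps)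
  qed
  have t0: "0 \<le> ?t" by (simp add: y_def)
  have "risk n K a b ?M \<sigma> \<le> measure_pmf.expectation ?P (\<lambda>X. measure_pmf.prob (?M (symmetrise X)) ?S)"
    unfolding p_def q_def by (rule risk_bounds(1))
  also have "\<dots> \<le> measure_pmf.expectation ?P (\<lambda>X. indicator ?B X + ?t)"
  proof (intro integral_mono integrable_prob Bochner_Integration.integrable_add)
    fix X
    show "measure_pmf.prob (?M (symmetrise X)) ?S \<le> indicator ?B X + ?t"
    proof (cases "X \<in> ?B")
      case True
      have "measure_pmf.prob (?M (symmetrise X)) ?S \<le> 1" by (rule measure_pmf.prob_le_1)
      moreover have "indicator ?B X = (1::real)" using True by simp
      ultimately show ?thesis using t0 by linarith
    next
      case False
      then show ?thesis
        using recovery_mech_error[of "symmetrise X" n K \<beta> p q c \<sigma> \<epsilon>] \<sigma> c \<open>\<epsilon> \<ge> 0\<close> small'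
        by (simp add: y_def c_def)
    qed
  qed (auto simp: measure_pmf.emeasure_eq_measure)
  also have "\<dots> = measure_pmf.prob ?P ?B + ?t"
    by (subst Bochner_Integration.integral_add) (auto simp: measure_pmf.emeasure_eq_measure)
  also have "measure_pmf.prob ?P ?B \<le> 6 * fact K * (real n * (real K * x))"
    unfolding p_def q_def c_def x_def
    using not_recoverable_prob_le[OF \<sigma> K \<beta> ab I] small by (simp add: x_def)
  finally show ?thesis by simp
qed

section \<open>Lower bound on the risk\<close>

lemma mismatch_zero_iff_same_class:
  assumes "mismatch n K \<sigma> \<tau> = 0" "i \<in> {1..n}" "j \<in> {1..n}"
  shows "\<sigma> i = \<sigma> j \<longleftrightarrow> \<tau> i = \<tau> j"
proof -
  obtain \<pi> where \<pi>: "\<pi> permutes {1..K}" "hamming n \<sigma> (\<pi> \<circ> \<tau>) = mismatch n K \<sigma> \<tau>"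
    by (rule mismatch_obtain)
  then have "{i \<in> {1..n}. \<sigma> i \<noteq> (\<pi> \<circ> \<tau>) i} = {}"
    using assms(1) unfolding hamming_def by simp
  then have "\<sigma> k = \<pi> (\<tau> k)" if "k \<in> {1..n}" for k using that by (metis (mono_tags, lifting) comp_apply empty_iff mem_Collect_eq)
  then show ?thesis using assms(2,3) permutes_inj[OF \<pi>(1)] by (metis injD)
qed

text \<open>Exchanging the labels of a node of community 1 and a node of community 2 keeps all
  community sizes. The bound on \<open>n\<close> forces at least two nodes into each community, so
  the result is not merely a relabeling.\<close>

lemma swap_labeling:
  assumes \<sigma>: "\<sigma> \<in> Sigma_beta n K \<beta>" and K: "2 \<le> K" "real K \<le> \<kappa>" and \<beta>: "1 \<le> \<beta>" and n: "\<beta> * \<kappa> < real n"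
  obtains \<sigma>' u v where "\<sigma>' \<in> Sigma_beta n K \<beta>" "u \<in> {1..n}" "v \<in> {1..n}"
    "\<And>i. i \<notin> {u, v} \<Longrightarrow> \<sigma>' i = \<sigma> i"
    "\<And>\<tau>. mismatch n K \<sigma> \<tau> = 0 \<Longrightarrow> mismatch n K \<sigma>' \<tau> \<noteq> 0"
proof -
  have "\<beta> * real K \<le> \<beta> * \<kappa>" using K \<beta> by (intro mult_left_mono) auto
  then have lt: "\<beta> * real K < real n" using n by linarith
  have "1 < real n / (\<beta> * real K)" using lt K \<beta> by (simp add: pos_less_divide_eq)
  then have size: "1 < card {i \<in> {1..n}. \<sigma> i = k}" if "k \<in> {1..K}" for k
    using Sigma_beta_sizes[OF \<sigma> that] by linarith
  \<comment> \<open>The second node \<open>u'\<close> separates the labelings: it shares the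
    community of \<open>u\<close> before the swap but not after, so no output fits both.\<close>
  obtain u u' where u: "u \<in> {1..n}" "u' \<in> {1..n}" "\<sigma> u = 1" "\<sigma> u' = 1" "u \<noteq> u'"
  proof -
    have "\<not> card {i \<in> {1..n}. \<sigma> i = 1} \<le> Suc 0" using size[of 1] K by simp
    then show ?thesis using that by (subst (asm) card_le_Suc0_iff_eq) auto
  qed
  obtain v where v: "v \<in> {1..n}" "\<sigma> v = 2"
  proof -
    have "1 < card {i \<in> {1..n}. \<sigma> i = 2}" using size K by auto
    then have "{i \<in> {1..n}. \<sigma> i = 2} \<noteq> {}" by (metis card.empty not_one_less_zero)
    then show ?thesis using that by blast
  qed
  let ?t = "Transposition.transpose u v"
  define \<sigma>' where "\<sigma>' = \<sigma> \<circ> ?t"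
  have t: "?t permutes {1..n}" using u v by (intro permutes_swap_id) auto
  have off: "\<sigma>' i = \<sigma> i" if "i \<notin> {u, v}" for i
    using that by (auto simp: \<sigma>'_def Transposition.transpose_def)
  have "\<sigma>' \<in> labelings n K"
  proof -
    have "\<sigma> \<in> labelings n K" using \<sigma> Sigma_beta_subset by auto
    then show ?thesis using t permutes_in_image[OF t] permutes_not_in[OF t]
      unfolding labelings_def \<sigma>'_def PiE_def Pi_def extensional_def by (auto simp del: atLeastAtMost_iff)
  qed
  moreover have "card {i \<in> {1..n}. \<sigma>' i = k} = card {i \<in> {1..n}. \<sigma> i = k}" for k
  proof -
    have "bij_betw ?t {i \<in> {1..n}. \<sigma>' i = k} {i \<in> {1..n}. \<sigma> i = k}"
    proof (rule bij_betwI[of _ _ _ ?t])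
      show "?t \<in> {i \<in> {1..n}. \<sigma>' i = k} \<rightarrow> {i \<in> {1..n}. \<sigma> i = k}"
        using permutes_in_image[OF t] by (auto simp: \<sigma>'_def simp del: atLeastAtMost_iff)
      show "?t \<in> {i \<in> {1..n}. \<sigma> i = k} \<rightarrow> {i \<in> {1..n}. \<sigma>' i = k}"
        using permutes_in_image[OF t] by (auto simp: \<sigma>'_def simp del: atLeastAtMost_iff)
    qed auto
    then show ?thesis by (rule bij_betw_same_card)
  qed
  ultimately have "\<sigma>' \<in> Sigma_beta n K \<beta>" using \<sigma> by (simp add: Sigma_beta_def)
  moreover have "mismatch n K \<sigma>' \<tau> \<noteq> 0" if m: "mismatch n K \<sigma> \<tau> = 0" for \<tau>
  proof
    assume m': "mismatch n K \<sigma>' \<tau> = 0"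
    have "\<sigma>' u = \<sigma>' u'"
      using mismatch_zero_iff_same_class[OF m u(1,2)] mismatch_zero_iff_same_class[OF m' u(1,2)] u v by simp
    moreover have "u' \<noteq> v" using u v by auto
    ultimately show False using u v off[of u'] by (auto simp: \<sigma>'_def)
  qed
  ultimately show ?thesis using that u v off by blast
qed

section \<open>Isolating nodes in a sample\<close>

definition erase :: "nat \<Rightarrow> nat set \<Rightarrow> (nat \<times> nat \<Rightarrow> bool) \<Rightarrow> nat \<times> nat \<Rightarrow> bool" where
  "erase n V X = (\<lambda>x. if x \<in> node_pairs n V then X x else False)"

text \<open>Privacy is only demanded on \<open>graphs n\<close>; samples qualify because they are
  \<open>False\<close> off the index set.\<close>

definition supported :: "nat \<Rightarrow> (nat \<times> nat \<Rightarrow> bool) \<Rightarrow> bool" where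
  "supported n X \<longleftrightarrow> (\<forall>x. x \<notin> node_pairs n {} \<longrightarrow> \<not> X x)"

lemma supported_erase: "supported n (erase n V X)"
  using node_pairs_mono by (auto simp: supported_def erase_def)

lemma erase_erase: "erase n W (erase n V X) = erase n (V \<union> W) X"
  by (auto simp: erase_def node_pairs_def fun_eq_iff)

lemma supported_edge_pmf:
  assumes "X \<in> set_pmf (edge_pmf n p q \<sigma>)"
  shows "supported n X"
proof -
  have "X \<in> {f. \<forall>x. x \<notin> node_pairs n {} \<longrightarrow> f x = False}"
    by (rule subsetD[OF set_Pi_pmf_subset[OF finite_node_pairs] assms[unfolded edge_pmf_def]])
  then show ?thesis unfolding supported_def mem_Collect_eq by blast
qed

lemma symmetrise_supported: 
  assumes "supported n X"
  shows "symmetrise X \<in> graphs n"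
proof -
  have X: "\<not> X x" if "x \<notin> node_pairs n {}" for x
    using assms that unfolding supported_def by blast
  have "i \<in> {1..n} \<and> j \<in> {1..n}" if "X (min i j, max i j)" for i j
  proof -
    have "(min i j, max i j) \<in> node_pairs n {}" using that X by blast
    then show ?thesis by (auto simp: node_pairs_def)
  qed
  moreover have "\<not> X (i, i)" for i using X[of "(i, i)"] by (auto simp: node_pairs_def)
  ultimately show ?thesis
    by (auto simp: graphs_def symmetrise_def min.commute max.commute)
qed

lemma node_adjacent_erase:
  assumes "supported n X" "v \<in> {1..n}"
  shows "node_adjacent n (symmetrise X) (symmetrise (erase n {v} X))"
proof -
  have "symmetrise X i j = symmetrise (erase n {v} X) i j" if "i \<noteq> v" "j \<noteq> v" for i j
  proof (cases "(min i j, max i j) \<in> node_pairs n {}")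
    case True
    then have "(min i j, max i j) \<in> node_pairs n {v}"
      using that by (auto simp: node_pairs_def min_def max_def)
    then show ?thesis by (simp add: symmetrise_def erase_def)
  next
    case False
    then have "(min i j, max i j) \<notin> node_pairs n {v}" using node_pairs_mono by blast
    then show ?thesis using False assms(1) by (simp add: symmetrise_def erase_def supported_def)
  qed
  then show ?thesis using assms(2) unfolding node_adjacent_def by blast
qed

text \<open>Isolate \<open>u\<close> and then \<open>v\<close>; each is a node-adjacent step costing
  \<open>exp \<epsilon>\<close>, and adjacency is symmetric.\<close>

lemma node_DP_erase:
  assumes M: "node_DP n K \<epsilon> M" and X: "supported n X" and uv: "u \<in> {1..n}" "v \<in> {1..n}"
  shows "measure_pmf.prob (M (symmetrise X)) S \<le> exp (2 * \<epsilon>) * measure_pmf.prob (M (symmetrise (erase n {u, v} X))) S"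
    and "measure_pmf.prob (M (symmetrise (erase n {u, v} X))) S \<le> exp (2 * \<epsilon>) * measure_pmf.prob (M (symmetrise X)) S"
proof -
  let ?g = "\<lambda>X. measure_pmf.prob (M (symmetrise X)) S"
  have step: "?g X \<le> exp \<epsilon> * ?g (erase n {w} X)" "?g (erase n {w} X) \<le> exp \<epsilon> * ?g X"
    if "supported n X" "w \<in> {1..n}" for X w
    using M symmetrise_supported[OF that(1)] symmetrise_supported[OF supported_erase, of n "{w}" X]
      node_adjacent_erase[OF that] node_adjacent_sym[OF node_adjacent_erase[OF that]]
    unfolding node_DP_def by blast+
  have e: "erase n {u, v} X = erase n {v} (erase n {u} X)" by (simp add: erase_erase insert_commute)
  have dbl: "exp (2 * \<epsilon>) * y = exp \<epsilon> * (exp \<epsilon> * y)" for y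
    by (simp only: mult_2 exp_add mult.assoc)
  show "?g X \<le> exp (2 * \<epsilon>) * ?g (erase n {u, v} X)"
    unfolding dbl e using step(1)[OF X uv(1)] step(1)[OF supported_erase uv(2), of "{u}" X]
    by (meson exp_ge_zero mult_left_mono order.trans)
  show "?g (erase n {u, v} X) \<le> exp (2 * \<epsilon>) * ?g X"
    unfolding dbl e using step(2)[OF X uv(1)] step(2)[OF supported_erase uv(2), of "{u}" X]
    by (meson exp_ge_zero mult_left_mono order.trans)
qed

text \<open>Surviving pairs have both ends outside \<open>V\<close>, where the two labelings
  coincide.\<close>

lemma map_erase_edge_pmf:
  assumes "\<And>i. i \<notin> V \<Longrightarrow> \<sigma>' i = \<sigma> i"
  shows "map_pmf (erase n V) (edge_pmf n p q \<sigma>') = map_pmf (erase n V) (edge_pmf n p q \<sigma>)"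
proof -
  have "map_pmf (erase n V) (edge_pmf n p q \<rho>)
      = Pi_pmf (node_pairs n V) False (\<lambda>x. bernoulli_pmf (edge_prob p q \<rho> x))" for \<rho>
    unfolding edge_pmf_def erase_def[abs_def] by (rule Pi_pmf_subset[symmetric]) (auto simp: node_pairs_mono)
  moreover have "Pi_pmf (node_pairs n V) False (\<lambda>x. bernoulli_pmf (edge_prob p q \<sigma>' x))
      = Pi_pmf (node_pairs n V) False (\<lambda>x. bernoulli_pmf (edge_prob p q \<sigma> x))"
    by (intro Pi_pmf_cong refl) (auto simp: node_pairs_def edge_prob_def assms)
  ultimately show ?thesis by simp
qed

text \<open>Instead of coupling the two models, both are compared with the common law of the graph in which
  \<open>u\<close> and \<open>v\<close> have been isolated; this costs \<open>2 \<epsilon>\<close> on each side.\<close>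

lemma node_DP_change_labeling:
  assumes M: "node_DP n K \<epsilon> M" and uv: "u \<in> {1..n}" "v \<in> {1..n}"
    and off: "\<And>i. i \<notin> {u, v} \<Longrightarrow> \<sigma>' i = \<sigma> i"
  shows "measure_pmf.expectation (edge_pmf n p q \<sigma>) (\<lambda>X. measure_pmf.prob (M (symmetrise X)) S)
    \<le> exp (4 * \<epsilon>) * measure_pmf.expectation (edge_pmf n p q \<sigma>') (\<lambda>X. measure_pmf.prob (M (symmetrise X)) S)"
proof -
  let ?g = "\<lambda>X. measure_pmf.prob (M (symmetrise X)) S"
  let ?P = "edge_pmf n p q \<sigma>" and ?Q = "edge_pmf n p q \<sigma>'"
  let ?e = "erase n {u, v}"
  have "measure_pmf.expectation ?P ?g \<le> measure_pmf.expectation ?P (\<lambda>X. exp (2 * \<epsilon>) * ?g (?e X))"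
    using node_DP_erase(1)[OF M supported_edge_pmf uv]
    by (intro integral_mono_AE integrable_mult_right integrable_prob AE_pmfI) auto
  also have "\<dots> = exp (2 * \<epsilon>) * measure_pmf.expectation (map_pmf ?e ?P) ?g" by simp
  also have "map_pmf ?e ?P = map_pmf ?e ?Q" by (rule map_erase_edge_pmf[OF off, symmetric])
  also have "exp (2 * \<epsilon>) * measure_pmf.expectation (map_pmf ?e ?Q) ?g
      = exp (2 * \<epsilon>) * measure_pmf.expectation ?Q (\<lambda>X. ?g (?e X))" by simp
  also have "\<dots> \<le> exp (2 * \<epsilon>) * measure_pmf.expectation ?Q (\<lambda>X. exp (2 * \<epsilon>) * ?g X)"
    using node_DP_erase(2)[OF M supported_edge_pmf uv]
    by (intro mult_left_mono integral_mono_AE integrable_mult_right integrable_prob AE_pmfI) auto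
  also have "\<dots> = (exp (2 * \<epsilon>) * exp (2 * \<epsilon>)) * measure_pmf.expectation ?Q ?g" by simp
  also have "exp (2 * \<epsilon>) * exp (2 * \<epsilon>) = exp (4 * \<epsilon>)" by (simp add: exp_add[symmetric])
  finally show ?thesis .
qed

text \<open>The event that the output fits \<open>\<sigma>\<close> serves as a test. No output fits
  both labelings, so its two errors are at most \<open>n\<close> times the two risks; Le Cam's bound
  and privacy each bound the sum of errors from below.\<close>

lemma two_point_risk_bound:
  assumes M: "node_DP n K \<epsilon> M" and "\<epsilon> \<ge> 0" and uv: "u \<in> {1..n}" "v \<in> {1..n}"
    and off: "\<And>i. i \<notin> {u, v} \<Longrightarrow> \<sigma>' i = \<sigma> i"
    and sep: "\<And>\<tau>. mismatch n K \<sigma> \<tau> = 0 \<Longrightarrow> mismatch n K \<sigma>' \<tau> \<noteq> 0"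
    and ab: "0 < b" "b < a" "a < real n" and I: "0 \<le> SBM_info n a b"
  shows "(exp (- 2 * (real n * SBM_info n a b)) + exp (- 4 * \<epsilon>)) / 4
    \<le> real n * (risk n K a b M \<sigma> + risk n K a b M \<sigma>')"
proof -
  define p q where "p = a / real n" and "q = b / real n"
  have n: "n \<ge> 1" using ab by (cases n) auto
  have pq: "0 < p" "p < 1" "0 < q" "q < 1" "p \<noteq> q" using ab n by (auto simp: p_def q_def)
  let ?P = "edge_pmf n p q \<sigma>" and ?Q = "edge_pmf n p q \<sigma>'"
  let ?T = "{\<tau>. mismatch n K \<sigma> \<tau> = 0}"
  let ?g = "\<lambda>X. measure_pmf.prob (M (symmetrise X)) ?T"
  let ?t = "measure_pmf.expectation ?P ?g" and ?t' = "measure_pmf.expectation ?Q ?g"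
  let ?R = "real n * (risk n K a b M \<sigma> + risk n K a b M \<sigma>')"
  have compl: "measure_pmf.prob (M (symmetrise X)) {\<tau>. mismatch n K \<sigma> \<tau> \<noteq> 0} = 1 - ?g X" for X
  proof -
    have "{\<tau>. mismatch n K \<sigma> \<tau> \<noteq> 0} = space (measure_pmf (M (symmetrise X))) - ?T" by auto
    then show ?thesis using measure_pmf.prob_compl[of ?T "M (symmetrise X)"] by (simp only:) simp
  qed
  have R0: "measure_pmf.expectation ?P (\<lambda>X. 1 - ?g X) \<le> real n * risk n K a b M \<sigma>"
    using risk_bounds(2)[of n a b \<sigma> M K] unfolding compl p_def q_def .
  have "?t' \<le> measure_pmf.expectation ?Q (\<lambda>X. measure_pmf.prob (M (symmetrise X)) {\<tau>. mismatch n K \<sigma>' \<tau> \<noteq> 0})"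
    using sep by (intro integral_mono integrable_prob measure_pmf.finite_measure_mono) auto
  also have "\<dots> \<le> real n * risk n K a b M \<sigma>'"
    unfolding p_def q_def by (rule risk_bounds(2))
  finally have R: "measure_pmf.expectation ?P (\<lambda>X. 1 - ?g X) + ?t' \<le> ?R"
    using R0 by (simp add: distrib_left)
  have t: "measure_pmf.expectation ?P (\<lambda>X. 1 - ?g X) = 1 - ?t"
    by (subst Bochner_Integration.integral_diff) (auto intro: integrable_prob)
  have t01: "0 \<le> ?t" "?t \<le> 1"
    using integral_mono[of "measure_pmf ?P" ?g "\<lambda>_. 1"] integrable_prob[of ?P "\<lambda>X. M (symmetrise X)" ?T]
    by (auto intro: Bochner_Integration.integral_nonneg)
  \<comment> \<open>Write 1 as \<open>?t + (1 - ?t)\<close>: privacy carries the first part over to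
    the other model, and the second is already an error under \<open>\<sigma>\<close>.\<close>
  have "exp (- 4 * \<epsilon>) \<le> ?R"
  proof -
    have "exp (- 4 * \<epsilon>) * ?t \<le> exp (- 4 * \<epsilon>) * (exp (4 * \<epsilon>) * ?t')"
      using node_DP_change_labeling[OF M uv off] by (intro mult_left_mono) auto
    also have "\<dots> = ?t'" by (simp add: mult.assoc[symmetric] exp_add[symmetric])
    finally have 1: "exp (- 4 * \<epsilon>) * ?t \<le> ?t'" .
    have "exp (- 4 * \<epsilon>) * (1 - ?t) \<le> 1 * (1 - ?t)"
      using t01 \<open>\<epsilon> \<ge> 0\<close> by (intro mult_right_mono) auto
    then show ?thesis using 1 R t by (simp add: algebra_simps)
  qed
  moreover have "exp (- 2 * (real n * SBM_info n a b)) / 2 \<le> ?R"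
  proof -
    \<comment> \<open>Every disagreement pair touches \<open>u\<close> or \<open>v\<close>, so there
      are at most \<open>2 n\<close>; two factors \<open>exp (- I / 2)\<close> per pair give the
      exponent \<open>2 n I\<close>.\<close>
    let ?N = "card (disagree n {} \<sigma> \<sigma>')"
    have "disagree n {u, v} \<sigma> \<sigma>' = {}" using off by (auto simp: disagree_def node_pairs_def)
    then have "?N \<le> card {u, v} * n" using card_disagree_restrict[of "{u, v}" n \<sigma> \<sigma>'] uv by simp
    also have "\<dots> \<le> 2 * n" by (intro mult_right_mono) (auto simp: card_insert_if)
    finally have N: "real ?N \<le> 2 * real n" by linarith
    have "real ?N * SBM_info n a b \<le> 2 * real n * SBM_info n a b" using N I by (intro mult_right_mono)
    then have "exp (- 2 * (real n * SBM_info n a b)) \<le> exp (- (real ?N * SBM_info n a b))" by simp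
    also have "\<dots> = affinity p q ^ (2 * ?N)"
      unfolding p_def q_def affinity_SBM_info[OF ab] exp_of_nat_mult[symmetric] by simp
    finally have "exp (- 2 * (real n * SBM_info n a b)) / 2 \<le> affinity p q ^ (2 * ?N) / 2" by simp
    also have "\<dots> \<le> measure_pmf.expectation ?P (\<lambda>X. 1 - ?g X) + ?t'"
      unfolding edge_pmf_def disagree_edge_prob[OF pq(5), symmetric]
      by (rule two_point_bound[OF finite_node_pairs pq(1-4)])
        (auto simp: edge_prob_def split: prod.splits)
    finally show ?thesis using R by linarith
  qed
  moreover have "(f + e) / 4 \<le> r" if "e \<le> r" "f / 2 \<le> r" "0 \<le> e" for e f r :: real
  proof -
    have "f + e \<le> 4 * r" using that by linarith
    then show ?thesis by simp
  qed
  ultimately show ?thesis using exp_ge_zero by blast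
qed

section \<open>From single models to the minimax risk\<close>

lemma bdd_above_risk: "bdd_above (risk n K a b M ` \<Sigma>)"
  by (rule bdd_aboveI[of _ 1]) (auto simp: risk_bounds(4))

text \<open>For every private mechanism the supremum dominates the mean of the two risks. The 8 is
  the 4 of the two-point bound times 2 from averaging.\<close>

lemma minimax_risk_ge:
  assumes ne: "Sigma_beta n K \<beta> \<noteq> {}" and K: "2 \<le> K" "real K \<le> \<kappa>" and \<beta>: "1 \<le> \<beta>"
    and n: "\<beta> * \<kappa> < real n" and "\<epsilon> \<ge> 0"
    and ab: "0 < b" "b < a" "a < real n" and I: "0 \<le> SBM_info n a b"
  shows "(exp (- 2 * (real n * SBM_info n a b)) + exp (- 4 * \<epsilon>)) / (8 * real n) \<le> minimax_risk \<epsilon> n K a b \<beta>"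
  unfolding minimax_risk_def
proof (rule cINF_greatest)
  \<comment> \<open>The recovery mechanism, with any parameters, shows that the infimum is over a
    nonempty set.\<close>
  show "{M. node_DP n K \<epsilon> M} \<noteq> {}" using node_DP_recovery_mech[OF ne \<open>\<epsilon> \<ge> 0\<close>] by blast
  fix M assume "M \<in> {M. node_DP n K \<epsilon> M}"
  then have M: "node_DP n K \<epsilon> M" by simp
  obtain \<sigma> where \<sigma>: "\<sigma> \<in> Sigma_beta n K \<beta>" using ne by blast
  obtain \<sigma>' u v where s: "\<sigma>' \<in> Sigma_beta n K \<beta>" "u \<in> {1..n}" "v \<in> {1..n}"
    "\<And>i. i \<notin> {u, v} \<Longrightarrow> \<sigma>' i = \<sigma> i"
    "\<And>\<tau>. mismatch n K \<sigma> \<tau> = 0 \<Longrightarrow> mismatch n K \<sigma>' \<tau> \<noteq> 0"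
    by (rule swap_labeling[OF \<sigma> K \<beta> n]) blast
  have npos: "0 < real n" using ab by linarith
  let ?S = "SUP \<sigma>\<^sub>0\<in>Sigma_beta n K \<beta>. risk n K a b M \<sigma>\<^sub>0"
  have "risk n K a b M \<sigma> \<le> ?S" "risk n K a b M \<sigma>' \<le> ?S"
    using \<sigma> s(1) by (auto intro!: cSUP_upper bdd_above_risk)
  then have "real n * (risk n K a b M \<sigma> + risk n K a b M \<sigma>') \<le> real n * (2 * ?S)"
    using npos by (intro mult_left_mono) auto
  moreover have "(exp (- 2 * (real n * SBM_info n a b)) + exp (- 4 * \<epsilon>)) / 4
    \<le> real n * (risk n K a b M \<sigma> + risk n K a b M \<sigma>')"
    by (rule two_point_risk_bound[OF M \<open>\<epsilon> \<ge> 0\<close> s(2-5) ab I])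
  ultimately have "exp (- 2 * (real n * SBM_info n a b)) + exp (- 4 * \<epsilon>) \<le> ?S * (8 * real n)"
    by (simp add: field_simps)
  then show "(exp (- 2 * (real n * SBM_info n a b)) + exp (- 4 * \<epsilon>)) / (8 * real n) \<le> ?S"
    using npos by (simp add: pos_divide_le_eq)
qed

lemma minimax_risk_le:
  assumes ne: "Sigma_beta n K \<beta> \<noteq> {}" and M: "node_DP n K \<epsilon> M"
    and le: "\<And>\<sigma>. \<sigma> \<in> Sigma_beta n K \<beta> \<Longrightarrow> risk n K a b M \<sigma> \<le> B"
  shows "minimax_risk \<epsilon> n K a b \<beta> \<le> B"
proof -
  have "minimax_risk \<epsilon> n K a b \<beta> \<le> (SUP \<sigma>\<^sub>0\<in>Sigma_beta n K \<beta>. risk n K a b M \<sigma>\<^sub>0)"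
    unfolding minimax_risk_def
  proof (rule cINF_lower)
    obtain \<sigma> where \<sigma>: "\<sigma> \<in> Sigma_beta n K \<beta>" using ne by blast
    have "0 \<le> (SUP \<sigma>\<^sub>0\<in>Sigma_beta n K \<beta>. risk n K a b M' \<sigma>\<^sub>0)" for M'
      using risk_bounds(3)[of n K a b M' \<sigma>] cSUP_upper[OF \<sigma> bdd_above_risk, of n K a b M'] by linarith
    then show "bdd_below ((\<lambda>M. SUP \<sigma>\<^sub>0\<in>Sigma_beta n K \<beta>. risk n K a b M \<sigma>\<^sub>0) ` {M. node_DP n K \<epsilon> M})"
      by (intro bdd_belowI[of _ 0]) auto
  qed (use M in simp)
  also have "\<dots> \<le> B" using ne le by (intro cSUP_least) auto
  finally show ?thesis .
qed

section \<open>The minimax rate\<close>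

text \<open>Move both exponents linearly from the rates \<open>t\<close>, \<open>t'\<close> to
  \<open>T\<close>, \<open>T'\<close>; by the intermediate value theorem the sum meets
  \<open>R\<close>. This turns two-sided bounds into an identity.\<close>

lemma exp_sum_between:
  fixes S \<epsilon> R t T t' T' :: real
  assumes "exp (- T * S) + exp (- T' * \<epsilon>) \<le> R" "R \<le> exp (- t * S) + exp (- t' * \<epsilon>)"
    and "t \<le> T" "t' \<le> T'" "0 \<le> S" "0 \<le> \<epsilon>"
  shows "\<exists>s u. t * S \<le> s \<and> s \<le> T * S \<and> t' * \<epsilon> \<le> u \<and> u \<le> T' * \<epsilon> \<and> R = exp (- s) + exp (- u)"
proof -
  define s u where "s = (\<lambda>\<theta>. (t + \<theta> * (T - t)) * S)" and "u = (\<lambda>\<theta>. (t' + \<theta> * (T' - t')) * \<epsilon>)"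
  define h where "h \<theta> = exp (- s \<theta>) + exp (- u \<theta>)" for \<theta>
  have "\<exists>\<theta>\<ge>0. \<theta> \<le> 1 \<and> h \<theta> = R"
  proof (rule IVT2')
    show "h 1 \<le> R" "R \<le> h 0" using assms(1,2) by (simp_all add: h_def s_def u_def)
    show "continuous_on {0..1} h" unfolding h_def[abs_def] s_def u_def by (intro continuous_intros)
  qed simp
  then obtain \<theta> where \<theta>: "0 \<le> \<theta>" "\<theta> \<le> 1" "h \<theta> = R" by blast
  have between: "v \<le> v + \<theta> * (w - v)" "v + \<theta> * (w - v) \<le> w" if "v \<le> w" for v w
    using \<theta> that mult_right_mono[of \<theta> 1 "w - v"] by auto
  have "t * S \<le> s \<theta>" "s \<theta> \<le> T * S" "t' * \<epsilon> \<le> u \<theta>" "u \<theta> \<le> T' * \<epsilon>"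
    unfolding s_def u_def using assms(3-6) between by (auto intro!: mult_right_mono)
  then show ?thesis using \<theta>(3) unfolding h_def by blast
qed

text \<open>The bounds carry polynomial factors, absorbed by giving up part of the exponents: 64 and
  \<open>8 / c\<close> are chosen so that \<open>n^2 K\<close> costs at most half of
  \<open>S / 16\<close>, and \<open>n^2\<close> at most half of
  \<open>c \<epsilon> / 2\<close>.\<close>

lemma minimax_risk_rate:
  fixes n K :: nat and a b \<beta> \<kappa> \<epsilon> F :: real
  defines "S \<equiv> Signal n K a b \<beta>" and "R \<equiv> minimax_risk \<epsilon> n K a b \<beta>" and "c \<equiv> 1 / (8 * \<beta> * \<kappa>)"
  assumes model: "SBM_model n K a b \<beta>" and K: "real K \<le> \<kappa>" and \<kappa>: "2 \<le> \<kappa>" and b: "0 < b"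
    and sig: "64 * ln (real n * real K) \<le> S" and \<epsilon>: "8 / c * ln (real n) \<le> \<epsilon>"
    and n: "\<beta> * \<kappa> < real n" and F: "fact K \<le> F"
  shows "1 / 8 * (exp (- (2 * \<beta> * \<kappa> + 1) * S) + exp (- 5 * \<epsilon>)) \<le> R"
    and "R \<le> 6 * F * (exp (- (1 / 32) * S) + exp (- (c / 4) * \<epsilon>))"
    and "ln (real n) \<le> S / 64" and "ln (real n) \<le> c / 8 * \<epsilon>" and "ln (real n) \<le> \<epsilon>"
proof -
  have m: "2 \<le> n" "2 \<le> K" "1 \<le> \<beta>" "b < a" "a < real n" "Sigma_beta n K \<beta> \<noteq> {}"
    using model by (auto simp: SBM_model_def)
  have bk: "2 \<le> \<beta> * \<kappa>" using mult_mono[of 1 \<beta> 2 \<kappa>] m \<kappa> by simp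
  have c: "0 < c" "c \<le> 1 / 16" using bk by (auto simp: c_def field_simps)
  have lnn: "0 \<le> ln (real n)" and lnK: "0 \<le> ln (real K)" using m by auto
  have ln_nK: "ln (real n * real K) = ln (real n) + ln (real K)" using m by (intro ln_mult_pos) auto
  show S64: "ln (real n) \<le> S / 64" using sig lnK unfolding ln_nK by simp
  show c8: "ln (real n) \<le> c / 8 * \<epsilon>" using \<epsilon> c by (simp add: field_simps)
  have S0: "0 \<le> S" using S64 lnn by linarith
  have e0: "0 \<le> \<epsilon>" using c8 lnn c by (metis divide_pos_pos order.trans zero_le_mult_iff zero_less_numeral linorder_not_le)
  have "c / 8 * \<epsilon> \<le> 1 * \<epsilon>" using c e0 by (intro mult_right_mono) auto
  then show lne: "ln (real n) \<le> \<epsilon>" using c8 by linarith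
  \<comment> \<open>Lets a condition on \<open>\<epsilon>\<close> in terms of \<open>ln n\<close>
    alone absorb the factor \<open>n K\<close>.\<close>
  have Kn: "real K \<le> real n"
  proof -
    have "\<kappa> \<le> \<beta> * \<kappa>" using m(3) \<kappa> by simp
    then show ?thesis using K n by linarith
  qed
  \<comment> \<open>Inverts the definition of \<open>Signal\<close>; for two communities the factor
    is 2, covered by \<open>\<beta> \<kappa> \<ge> 2\<close>.\<close>
  have nI: "0 \<le> real n * SBM_info n a b \<and> real n * SBM_info n a b \<le> \<beta> * \<kappa> * S"
  proof (cases "K = 2")
    case True
    then have "real n * SBM_info n a b = 2 * S" by (simp add: S_def Signal_def)
    then show ?thesis using S0 bk by (auto intro: mult_right_mono)
  next
    case False
    then have "real n * SBM_info n a b = \<beta> * real K * S" using m by (simp add: S_def Signal_def)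
    moreover have "\<beta> * real K \<le> \<beta> * \<kappa>" using K m by (intro mult_left_mono) auto
    ultimately show ?thesis using S0 m by (auto intro!: mult_right_mono)
  qed
  then have I: "0 \<le> SBM_info n a b" using m by (simp add: zero_le_mult_iff)

  have inv_n: "exp (- z) \<le> 1 / real n" if "ln (real n) \<le> z" for z
  proof -
    have "exp (- z) \<le> exp (- ln (real n))" using that by simp
    also have "\<dots> = 1 / real n" using m by (simp add: exp_minus inverse_eq_divide)
    finally show ?thesis .
  qed
  \<comment> \<open>The factor \<open>1 / n\<close> of the lower bound costs one further
    \<open>S\<close> in the exponent, and below one further \<open>\<epsilon>\<close>.\<close>
  have "exp (- (2 * \<beta> * \<kappa> + 1) * S) \<le> exp (- 2 * (real n * SBM_info n a b)) * (1 / real n)"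
  proof -
    have "exp (- (2 * \<beta> * \<kappa> + 1) * S) = exp (- 2 * (\<beta> * \<kappa> * S)) * exp (- S)"
      unfolding exp_add[symmetric] by (simp add: algebra_simps)
    also have "\<dots> \<le> exp (- 2 * (real n * SBM_info n a b)) * (1 / real n)"
      using nI S64 S0 by (intro mult_mono inv_n) auto
    finally show ?thesis .
  qed
  moreover have "exp (- 5 * \<epsilon>) \<le> exp (- 4 * \<epsilon>) * (1 / real n)"
  proof -
    have "exp (- 5 * \<epsilon>) = exp (- 4 * \<epsilon>) * exp (- \<epsilon>)"
      unfolding exp_add[symmetric] by simp
    also have "\<dots> \<le> exp (- 4 * \<epsilon>) * (1 / real n)"
      using lne by (intro mult_left_mono inv_n) auto
    finally show ?thesis .
  qed
  ultimately have "1 / 8 * (exp (- (2 * \<beta> * \<kappa> + 1) * S) + exp (- 5 * \<epsilon>))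
      \<le> (exp (- 2 * (real n * SBM_info n a b)) + exp (- 4 * \<epsilon>)) / (8 * real n)"
    by (simp add: add_divide_distrib)
  also have "\<dots> \<le> R"
    unfolding R_def by (rule minimax_risk_ge[OF m(6) m(2) K m(3) n e0 b m(4,5) I])
  finally show "1 / 8 * (exp (- (2 * \<beta> * \<kappa> + 1) * S) + exp (- 5 * \<epsilon>)) \<le> R" .

  define x where "x = real n * exp (- S / 16)"
  define y where "y = exp (- \<epsilon> * (1 / (8 * \<beta> * \<kappa>)) / 2)"
  have x: "real n * (real K * x) \<le> exp (- (1 / 32) * S)"
  proof -
    have "real n * (real K * x) = exp (ln (real n)) * (exp (ln (real K)) * (exp (ln (real n)) * exp (- S / 16)))"
      using m by (simp add: x_def)
    also have "\<dots> = exp (2 * ln (real n) + ln (real K) - S / 16)"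
      unfolding exp_add[symmetric] by (simp add: algebra_simps)
    also have "\<dots> \<le> exp (- (1 / 32) * S)"
      using sig lnn lnK unfolding ln_nK by simp
    finally show ?thesis .
  qed
  have y: "real n * (real K * y) \<le> exp (- (c / 4) * \<epsilon>)"
  proof -
    have "real n * (real K * y) \<le> real n * (real n * y)"
      using Kn by (intro mult_left_mono mult_right_mono) (auto simp: y_def)
    also have "\<dots> = exp (ln (real n)) * (exp (ln (real n)) * exp (- (c / 2) * \<epsilon>))"
      using m by (simp add: y_def c_def mult.commute)
    also have "\<dots> = exp (2 * ln (real n) - c / 2 * \<epsilon>)"
      unfolding exp_add[symmetric] by (simp add: algebra_simps)
    also have "\<dots> \<le> exp (- (c / 4) * \<epsilon>)" using c8 by simp
    finally show ?thesis .
  qed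
  have small: "real n * (real K * x) \<le> 1" "real n * (real K * y) \<le> 1"
    using x y S0 e0 c by (auto elim!: order.trans)
  let ?M = "recovery_mech n K \<beta> (a / real n) (b / real n) (1 / (8 * \<beta> * \<kappa>)) \<epsilon>"
  have "R \<le> 6 * fact K * (real n * (real K * x)) + 2 * fact K * (real n * (real K * y))"
    unfolding R_def
  proof (rule minimax_risk_le[OF m(6) node_DP_recovery_mech[OF m(6) e0]])
    fix \<sigma> assume "\<sigma> \<in> Sigma_beta n K \<beta>"
    then show "risk n K a b ?M \<sigma> \<le> 6 * fact K * (real n * (real K * x)) + 2 * fact K * (real n * (real K * y))"
      using risk_recovery_mech_le[OF _ m(2) K m(3) b m(4,5) I _ e0] small
      unfolding x_def y_def S_def by blast
  qed
  also have "\<dots> \<le> 6 * F * exp (- (1 / 32) * S) + 6 * F * exp (- (c / 4) * \<epsilon>)"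
  proof -
    have F0: "0 \<le> F" using F by (meson fact_ge_zero order.trans)
    have "6 * fact K \<le> 6 * F" "2 * fact K \<le> 6 * F" using F F0 by linarith+
    then show ?thesis
      using F0 by (intro add_mono mult_mono[OF _ x] mult_mono[OF _ y]) (auto simp: x_def y_def)
  qed
  finally show "R \<le> 6 * F * (exp (- (1 / 32) * S) + exp (- (c / 4) * \<epsilon>))"
    by (simp only: distrib_left)
qed

text \<open>Constants are chosen before the sequences, hence uniform over the regime. The last
  conjunct expresses the \<open>Theta\<close> form of the rate as an exact identity with exponents
  between fixed multiples.\<close>

theorem corollary4p4:
  shows "\<exists>C0>0. \<forall>C_s\<ge>C0. \<forall>(\<beta>::real) (\<rho>\<^sub>m::real) (\<rho>\<^sub>p::real) (K_max::real) (C_a::real).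
    \<beta> \<ge> 1 \<and> 0 < \<rho>\<^sub>m \<and> \<rho>\<^sub>m \<le> \<rho>\<^sub>p \<and> \<rho>\<^sub>p < 1 \<and> C_a > 0 \<longrightarrow>
    (\<exists>L>0. \<exists>c_sig>0. \<exists>c_priv>0. \<exists>C_sig>0. \<exists>C_priv>0. \<exists>D_lower>0. \<exists>D_upper>0.
     \<exists>t_sig>0. \<exists>t_priv>0. \<exists>T_sig>0. \<exists>T_priv>0.
      \<forall>(K::nat \<Rightarrow> nat) (a::nat \<Rightarrow> real) (b::nat \<Rightarrow> real) (\<epsilon>::nat \<Rightarrow> real).
        (\<forall>\<^sub>F n in sequentially. \<rho>\<^sub>m \<le> b n / a n \<and> b n / a n \<le> \<rho>\<^sub>p) \<and>
        (\<forall>\<^sub>F n in sequentially.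
           Signal n (K n) (a n) (b n) \<beta> \<ge> C_s * ln (real n * real (K n))) \<and>
        (\<exists>C_mg>0. \<forall>\<^sub>F n in sequentially.
           ln (real n * real (K n)) \<ge> C_mg * real (K n) * ln (real (K n))) \<and>
        a \<in> o(\<lambda>n. real n) \<and> b \<in> o(\<lambda>n. real n) \<and>
        (\<forall>\<^sub>F n in sequentially. ln (real n) \<le> C_a * a n) \<and>
        (\<forall>\<^sub>F n in sequentially. real (K n) \<le> K_max) \<longrightarrow>
        (\<forall>\<^sub>F n in sequentially.
           SBM_model n (K n) (a n) (b n) \<beta> \<longrightarrow> \<epsilon> n \<ge> L * ln (real n) \<longrightarrow>
           (let S = Signal n (K n) (a n) (b n) \<beta>;
                R = minimax_risk (\<epsilon> n) n (K n) (a n) (b n) \<beta>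
            in D_lower * (exp (- C_sig * S) + exp (- C_priv * \<epsilon> n)) \<le> R \<and>
               R \<le> D_upper * (exp (- c_sig * S) + exp (- c_priv * \<epsilon> n)) \<and>
               (\<exists>s t. t_sig * S \<le> s \<and> s \<le> T_sig * S \<and>
                      t_priv * \<epsilon> n \<le> t \<and> t \<le> T_priv * \<epsilon> n \<and>
                      R = exp (- s) + exp (- t)))))"
proof (rule exI[of _ 64], intro conjI allI impI, goal_cases)
  case (2 C_s \<beta> \<rho>\<^sub>m \<rho>\<^sub>p K_max C_a)
  then have "64 \<le> C_s" "1 \<le> \<beta>" "0 < \<rho>\<^sub>m" by auto
  \<comment> \<open>All constants are built from \<open>\<kappa>\<close> because \<open>K n\<close>
    may vary; the maximum with 2 keeps \<open>\<beta> \<kappa> \<ge> 2\<close> for every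
    \<open>K_max\<close>.\<close>
  define \<kappa> where "\<kappa> = max 2 K_max"
  define c where "c = 1 / (8 * \<beta> * \<kappa>)"
  define F :: real where "F = fact (nat \<lfloor>\<kappa>\<rfloor>)"
  have \<kappa>: "2 \<le> \<kappa>" "K_max \<le> \<kappa>" by (auto simp: \<kappa>_def)
  have bk: "2 \<le> \<beta> * \<kappa>" using mult_mono[of 1 \<beta> 2 \<kappa>] \<open>1 \<le> \<beta>\<close> \<kappa> by simp
  have c: "0 < c" "c \<le> 1 / 16" using bk by (auto simp: c_def field_simps)
  have F: "1 \<le> F" unfolding F_def by simp
  have main: "let S = Signal n K a b \<beta>; R = minimax_risk \<epsilon> n K a b \<beta>
      in 1 / 8 * (exp (- (2 * \<beta> * \<kappa> + 1) * S) + exp (- 5 * \<epsilon>)) \<le> R \<and>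
         R \<le> 6 * F * (exp (- (1 / 32) * S) + exp (- (c / 4) * \<epsilon>)) \<and>
         (\<exists>s t. 1 / 64 * S \<le> s \<and> s \<le> (2 * \<beta> * \<kappa> + 2) * S \<and>
                c / 8 * \<epsilon> \<le> t \<and> t \<le> 6 * \<epsilon> \<and> R = exp (- s) + exp (- t))"
    if model: "SBM_model n K a b \<beta>" and eps: "8 / c * ln (real n) \<le> \<epsilon>"
      and ratio: "\<rho>\<^sub>m \<le> b / a" and sig: "C_s * ln (real n * real K) \<le> Signal n K a b \<beta>"
      and K: "real K \<le> K_max" and n: "max (\<beta> * \<kappa>) (max 8 (6 * F)) < real n"
    for n K :: nat and a b \<epsilon> :: real
  proof -
    define S R where "S = Signal n K a b \<beta>" and "R = minimax_risk \<epsilon> n K a b \<beta>"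
    have m: "2 \<le> n" "2 \<le> K" "b < a" "0 \<le> b" using model by (auto simp: SBM_model_def)
    \<comment> \<open>A ratio of at least \<open>\<rho>\<^sub>m > 0\<close> excludes
      \<open>b = 0\<close>.\<close>
    have b: "0 < b" using m ratio \<open>0 < \<rho>\<^sub>m\<close> by (cases "b = 0") auto
    have "1 * 1 \<le> real n * real K" using m by (intro mult_mono) auto
    then have "0 \<le> ln (real n * real K)" by simp
    then have "64 * ln (real n * real K) \<le> C_s * ln (real n * real K)"
      using \<open>64 \<le> C_s\<close> by (intro mult_right_mono)
    then have sig': "64 * ln (real n * real K) \<le> Signal n K a b \<beta>" using sig by linarith
    have K\<kappa>: "real K \<le> \<kappa>" using K \<kappa> by linarith
    then have "K \<le> nat \<lfloor>\<kappa>\<rfloor>" by (simp add: le_nat_floor)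
    then have FK: "fact K \<le> F" unfolding F_def by (rule fact_mono)
    \<comment> \<open>Since \<open>n\<close> exceeds 8 and \<open>6 * F\<close>, the spare
      \<open>ln n\<close> in the exponents pays for these prefactors.\<close>
    have n': "\<beta> * \<kappa> < real n" "8 < real n" "6 * F < real n" using n by auto
    note rate = minimax_risk_rate[OF model K\<kappa> \<kappa>(1) b sig' eps[unfolded c_def] n'(1) FK,
        folded c_def S_def R_def]
    have lnn: "0 \<le> ln (real n)" using m by simp
    have S0: "0 \<le> S" and e0: "0 \<le> \<epsilon>" using rate(3,5) lnn by linarith+
    have eighth: "exp (- z) \<le> 1 / 8" if "ln (real n) \<le> z" for z
    proof -
      have "exp (- z) \<le> exp (- ln (real n))" using that by simp
      also have "\<dots> = 1 / real n" using m by (simp add: exp_minus inverse_eq_divide)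
      also have "\<dots> \<le> 1 / 8" using n'(2) by (intro divide_left_mono) auto
      finally show ?thesis .
    qed
    have six: "6 * F \<le> exp z" if "ln (real n) \<le> z" for z
    proof -
      have "6 * F \<le> exp (ln (real n))" using n'(3) m by simp
      also have "\<dots> \<le> exp z" using that by simp
      finally show ?thesis .
    qed
    \<comment> \<open>One more \<open>S\<close> and one more \<open>\<epsilon>\<close> in the
      exponents remove the prefactor \<open>1 / 8\<close>.\<close>
    have "exp (- (2 * \<beta> * \<kappa> + 2) * S) + exp (- 6 * \<epsilon>) \<le> R"
    proof -
      have "exp (- (2 * \<beta> * \<kappa> + 2) * S) = exp (- S) * exp (- (2 * \<beta> * \<kappa> + 1) * S)"
        "exp (- 6 * \<epsilon>) = exp (- \<epsilon>) * exp (- 5 * \<epsilon>)"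
        unfolding exp_add[symmetric] by (simp_all add: algebra_simps)
      moreover have "exp (- S) * exp (- (2 * \<beta> * \<kappa> + 1) * S) \<le> 1 / 8 * exp (- (2 * \<beta> * \<kappa> + 1) * S)"
        using rate(3) S0 by (intro mult_right_mono eighth) auto
      moreover have "exp (- \<epsilon>) * exp (- 5 * \<epsilon>) \<le> 1 / 8 * exp (- 5 * \<epsilon>)"
        using rate(5) by (intro mult_right_mono eighth) auto
      ultimately show ?thesis using rate(1) unfolding distrib_left by linarith
    qed
    \<comment> \<open>Halving both rates removes the prefactor \<open>6 * F\<close>.\<close>
    moreover have "R \<le> exp (- (1 / 64) * S) + exp (- (c / 8) * \<epsilon>)"
    proof -
      have "exp (- (1 / 64) * S) = exp (S / 64) * exp (- (1 / 32) * S)"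
        "exp (- (c / 8) * \<epsilon>) = exp (c / 8 * \<epsilon>) * exp (- (c / 4) * \<epsilon>)"
        unfolding exp_add[symmetric] by (simp_all add: algebra_simps)
      moreover have "6 * F * exp (- (1 / 32) * S) \<le> exp (S / 64) * exp (- (1 / 32) * S)"
        using rate(3) by (intro mult_right_mono six) auto
      moreover have "6 * F * exp (- (c / 4) * \<epsilon>) \<le> exp (c / 8 * \<epsilon>) * exp (- (c / 4) * \<epsilon>)"
        using rate(4) by (intro mult_right_mono six) auto
      ultimately show ?thesis using rate(2) unfolding distrib_left by linarith
    qed
    ultimately have "\<exists>s t. 1 / 64 * S \<le> s \<and> s \<le> (2 * \<beta> * \<kappa> + 2) * S \<and>
        c / 8 * \<epsilon> \<le> t \<and> t \<le> 6 * \<epsilon> \<and> R = exp (- s) + exp (- t)"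
      using bk c S0 e0 by (intro exp_sum_between) auto
    then show ?thesis using rate(1,2) unfolding Let_def S_def R_def by blast
  qed
  show ?case
  \<comment> \<open>The witnesses depend only on \<open>\<beta>\<close>, \<open>\<kappa>\<close> and
    \<open>F\<close>, all fixed before the sequences.\<close>
  proof (rule exI[of _ "8 / c"], rule conjI[rotated],
      rule exI[of _ "1 / 32"], rule conjI[rotated],
      rule exI[of _ "c / 4"], rule conjI[rotated],
      rule exI[of _ "2 * \<beta> * \<kappa> + 1"], rule conjI[rotated],
      rule exI[of _ "5"], rule conjI[rotated],
      rule exI[of _ "1 / 8"], rule conjI[rotated],
      rule exI[of _ "6 * F"], rule conjI[rotated],
      rule exI[of _ "1 / 64"], rule conjI[rotated],
      rule exI[of _ "c / 8"], rule conjI[rotated],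
      rule exI[of _ "2 * \<beta> * \<kappa> + 2"], rule conjI[rotated],
      rule exI[of _ "6"], rule conjI[rotated], intro allI impI, goal_cases)
    case (1 K a b \<epsilon>)
    then have "\<forall>\<^sub>F n in sequentially. \<rho>\<^sub>m \<le> b n / a n \<and> b n / a n \<le> \<rho>\<^sub>p"
      "\<forall>\<^sub>F n in sequentially. C_s * ln (real n * real (K n)) \<le> Signal n (K n) (a n) (b n) \<beta>"
      "\<forall>\<^sub>F n in sequentially. real (K n) \<le> K_max"
      by blast+
    moreover have "\<forall>\<^sub>F n in sequentially. max (\<beta> * \<kappa>) (max 8 (6 * F)) < real n"
      using filterlim_real_sequentially unfolding filterlim_at_top_dense by blast
    ultimately show ?case
    proof eventually_elim
      case (elim n)
      then show ?case by (intro impI main) auto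
    qed
  qed (use bk c F in auto)
qed simp

end
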